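(* Let $q,r\ge 2$ and let $L$ be a block-permutational Sudoku Latin square of order $qr$ of type $(q,r)$. Let $k_1,k_2$ be two distinct symbols occurring in a common column of the block $L[1,1]$. Let $L'$ be the Sudoku Latin square obtained from $L$ by interchanging the symbols $k_1$ and $k_2$ in all the blocks $B_{1,1},B_{1,2},\ldots,B_{1,q}$ of the first row-block, all other entries being unchanged. Let $A_L$, $A_{L'}$ be the adjacency matrices of the Latin square graphs of $L$ and $L'$, and let $B$ be the block matrix defined in the context. Then, as multisets, $$\mathrm{Spec}(A_{L'}+B)=(\mathrm{Spec}(A_L+B)\setminus X)\cup Y,$$ where \begin{align*} \mathrm{Spec}(A_L+B)=\{&[(q-1)(r-1)+3qr-3]^1,\ [(q-1)(r-1)+qr-3]^{q+r-2},\\ &[(q-1)(r-1)-3]^{(q-1)(r-1)},\ [qr-2]^{(q-1)(r-1)},\\ &[qr-q-2]^{(q+1)(r-1)},\ [qr-r-2]^{(q-1)(r+1)},\ [-2]^{(q-1)(r-1)(qr-1)},\\ &[-q-2]^{(r-1)(qr-q-1)},\ [-r-2]^{(q-1)(qr-r-1)}\}, \end{align*} $$X=\{-2,\,-r-2,\,qr-2,\,qr-r-2\},$$ $$Y=\left\{\tfrac12\left((q-1)r-4\pm\sqrt{(q^2+1)r^2\pm 2q(r-2)\sqrt{r^2+4r-4}}\right)\right\},$$ the two signs in $Y$ being chosen independently, so that $Y$ is a multiset of four elements.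
   Context: $[n]=\{1,\ldots,n\}$. A Latin square of order $n$ on $[n]$ is an $n\times n$ array with entries in $[n]$ such that every row and every column contains each symbol exactly once. For $i\in[r]$, $j\in[q]$ put $B_{i,j}=\{(a,b): (i-1)q+1\le a\le iq,\ (j-1)r+1\le b\le jr\}$; these $q\times r$ blocks partition $[qr]^2$. A Latin square of order $qr$ is a Sudoku Latin square of type $(q,r)$ if in each block $B_{i,j}$ every symbol of $[qr]$ occurs exactly once. $L[i,j]$ denotes the $q\times r$ subarray of $L$ on $B_{i,j}$. $L$ is block-permutational if for all $i\in[r],j\in[q]$ there exist permutation matrices $P$ of order $q$ and $Q$ of order $r$ (depending on $i,j$) with $L[i,j]=P^{-1}L[1,1]Q$. Index matrices by cells $(a,b)\in[qr]^2$. For a Latin square $L$ of order $qr$, $A_L$ is the $(0,1)$-matrix whose $((a,b),(a',b'))$-entry is $1$ iff the cells are distinct and $a=a'$, or $b=b'$, or $L(a,b)=L(a',b')$. $B$ is the $(0,1)$-matrix whose $((a,b),(a',b'))$-entry is $1$ iff $(a,b),(a',b')$ lie in a common block $B_{i,j}$ and $a\neq a'$, $b\ne b'$. $\mathrm{Spec}$ is the multiset of eigenvalues; $[\theta]^m$ means $\theta$ listed with multiplicity $m$, where listed values that coincide have their multiplicities added. Set difference and union are multiset operations (multiplicities are subtracted, respectively added). *)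

theory Defs
  imports "Jordan_Normal_Form.Char_Poly" "HOL-Combinatorics.Transposition"
begin

text \<open>
  An \<open>n \<times> n\<close> array is a function \<open>L :: nat \<Rightarrow> nat \<Rightarrow> nat\<close> of which only the values
  \<open>L a b\<close> with \<open>a, b \<in> {1..n}\<close> (rows and columns counted from 1) are relevant.
\<close>

definition latin_square :: "nat \<Rightarrow> (nat \<Rightarrow> nat \<Rightarrow> nat) \<Rightarrow> bool" where
  "latin_square n L \<longleftrightarrow>
     (\<forall>a\<in>{1..n}. \<forall>b\<in>{1..n}. L a b \<in> {1..n}) \<and>
     (\<forall>a\<in>{1..n}. \<forall>k\<in>{1..n}. \<exists>!b. b \<in> {1..n} \<and> L a b = k) \<and>
     (\<forall>b\<in>{1..n}. \<forall>k\<in>{1..n}. \<exists>!a. a \<in> {1..n} \<and> L a b = k)"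

definition block :: "nat \<Rightarrow> nat \<Rightarrow> nat \<Rightarrow> nat \<Rightarrow> (nat \<times> nat) set" where
  "block q r i j = {(a, b). (i - 1) * q + 1 \<le> a \<and> a \<le> i * q \<and> (j - 1) * r + 1 \<le> b \<and> b \<le> j * r}"

definition sudoku_latin_square :: "nat \<Rightarrow> nat \<Rightarrow> (nat \<Rightarrow> nat \<Rightarrow> nat) \<Rightarrow> bool" where
  "sudoku_latin_square q r L \<longleftrightarrow>
     latin_square (q * r) L \<and>
     (\<forall>i\<in>{1..r}. \<forall>j\<in>{1..q}. \<forall>k\<in>{1..q * r}.
        \<exists>!c. c \<in> block q r i j \<and> L (fst c) (snd c) = k)"

text \<open>
  The subarray of \<open>L\<close> on \<open>block q r i j\<close> as a \<open>q \<times> r\<close> matrix; its indices count from 0,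
  those of \<open>L\<close> from 1.
\<close>

definition subarray :: "nat \<Rightarrow> nat \<Rightarrow> (nat \<Rightarrow> nat \<Rightarrow> nat) \<Rightarrow> nat \<Rightarrow> nat \<Rightarrow> int mat" where
  "subarray q r L i j =
     mat q r (\<lambda>(s, t). int (L ((i - 1) * q + 1 + s) ((j - 1) * r + 1 + t)))"

definition permutation_matrix :: "nat \<Rightarrow> int mat \<Rightarrow> bool" where
  "permutation_matrix n P \<longleftrightarrow>
     P \<in> carrier_mat n n \<and>
     (\<forall>s<n. \<forall>t<n. P $$ (s, t) \<in> {0, 1}) \<and>
     (\<forall>s<n. \<exists>!t. t < n \<and> P $$ (s, t) = 1) \<and>
     (\<forall>t<n. \<exists>!s. s < n \<and> P $$ (s, t) = 1)"

text \<open>\<open>P'\<close> is the inverse of \<open>P\<close>.\<close>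

definition block_permutational :: "nat \<Rightarrow> nat \<Rightarrow> (nat \<Rightarrow> nat \<Rightarrow> nat) \<Rightarrow> bool" where
  "block_permutational q r L \<longleftrightarrow>
     (\<forall>i\<in>{1..r}. \<forall>j\<in>{1..q}. \<exists>P P' Q.
        permutation_matrix q P \<and> permutation_matrix r Q \<and>
        P' \<in> carrier_mat q q \<and> inverts_mat P P' \<and> inverts_mat P' P \<and>
        subarray q r L i j = P' * subarray q r L 1 1 * Q)"

definition swap_in_first_row_block ::
    "nat \<Rightarrow> nat \<Rightarrow> nat \<Rightarrow> nat \<Rightarrow> (nat \<Rightarrow> nat \<Rightarrow> nat) \<Rightarrow> nat \<Rightarrow> nat \<Rightarrow> nat" where
  "swap_in_first_row_block q r k1 k2 L a b =
     (if (a, b) \<in> (\<Union>j\<in>{1..q}. block q r 1 j)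
      then Transposition.transpose k1 k2 (L a b) else L a b)"

text \<open>
  Matrices indexed by the cells \<open>{1..n} \<times> {1..n}\<close> are represented with the cells enumerated
  row by row; the spectrum does not depend on the enumeration.
\<close>

definition cell :: "nat \<Rightarrow> nat \<Rightarrow> nat \<times> nat" where
  "cell n s = (s div n + 1, s mod n + 1)"

lemma bij_betw_cell: "bij_betw (cell n) {..<n * n} ({1..n} \<times> {1..n})"
proof (rule bij_betwI[where g = "\<lambda>(a, b). (a - 1) * n + (b - 1)"])
  show "cell n \<in> {..<n * n} \<rightarrow> {1..n} \<times> {1..n}"
  proof
    fix s assume "s \<in> {..<n * n}"
    then have "s < n * n" by simp
    moreover from this have "0 < n" by (cases n) auto
    ultimately have "s div n < n" and "s mod n < n"
      by (simp add: less_mult_imp_div_less, simp)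
    then show "cell n s \<in> {1..n} \<times> {1..n}" by (simp add: cell_def Suc_le_eq)
  qed
  show "(\<lambda>(a, b). (a - 1) * n + (b - 1)) \<in> {1..n} \<times> {1..n} \<rightarrow> {..<n * n}"
  proof
    fix c assume "c \<in> {1..n} \<times> {1..n}"
    then obtain a b where c: "c = (a, b)" and "a \<in> {1..n}" "b \<in> {1..n}" by auto
    from \<open>b \<in> {1..n}\<close> have "(a - 1) * n + (b - 1) < (a - 1) * n + n" by auto
    also have "\<dots> = a * n" using \<open>a \<in> {1..n}\<close> by (cases a) auto
    also have "\<dots> \<le> n * n" using \<open>a \<in> {1..n}\<close> by simp
    finally show "(case c of (a, b) \<Rightarrow> (a - 1) * n + (b - 1)) \<in> {..<n * n}" using c by simp
  qed
next
  fix s assume "s \<in> {..<n * n}"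
  show "(case cell n s of (a, b) \<Rightarrow> (a - 1) * n + (b - 1)) = s" by (simp add: cell_def)
next
  fix c assume "c \<in> {1..n} \<times> {1..n}"
  then obtain a b where "c = (Suc a, Suc b)" "b < n"
    by (cases c; cases "fst c"; cases "snd c") auto
  then show "cell n (case c of (a, b) \<Rightarrow> (a - 1) * n + (b - 1)) = c" by (simp add: cell_def)
qed

definition cell_matrix :: "nat \<Rightarrow> (nat \<times> nat \<Rightarrow> nat \<times> nat \<Rightarrow> bool) \<Rightarrow> complex mat" where
  "cell_matrix n R = mat (n * n) (n * n) (\<lambda>(s, t). if R (cell n s) (cell n t) then 1 else 0)"

definition latin_square_graph_matrix :: "nat \<Rightarrow> (nat \<Rightarrow> nat \<Rightarrow> nat) \<Rightarrow> complex mat" where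
  "latin_square_graph_matrix n L =
     cell_matrix n (\<lambda>(a, b) (a', b').
       (a, b) \<noteq> (a', b') \<and> (a = a' \<or> b = b' \<or> L a b = L a' b'))"

definition block_matrix :: "nat \<Rightarrow> nat \<Rightarrow> complex mat" where
  "block_matrix q r =
     cell_matrix (q * r) (\<lambda>(a, b) (a', b').
       (\<exists>i\<in>{1..r}. \<exists>j\<in>{1..q}. (a, b) \<in> block q r i j \<and> (a', b') \<in> block q r i j) \<and>
       a \<noteq> a' \<and> b \<noteq> b')"

text \<open>Over the complex numbers this contains all eigenvalues, with algebraic multiplicities.\<close>

definition Spec :: "complex mat \<Rightarrow> complex multiset" where
  "Spec A = proots (char_poly A)"

end

theory Submission
  imports Defs "Jordan_Normal_Form.Schur_Decomposition"
begin

text \<open>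
  Block-permutationality says that all blocks partition the symbols in the same way by their rows and by
  their columns, so a symbol is a pair \<open>(x, y)\<close> of classes. Up to scalars, \<open>A + B\<close> is a combination
  of averaging operators over partitions of the cells (rows, columns, symbols, blocks, rows and columns of
  blocks). Any two of these partitions, and their joins, are fixed by subsets of the coordinates in a
  common coordinate system, so the averaging operators multiply like the join of the partitions. Moebius
  inversion turns them into orthogonal idempotents that sum to 1; their traces are the multiplicities of
  the eigenvalues.

  Interchanging \<open>k1\<close> and \<open>k2\<close> subtracts \<open>s t\<^sup>T + t s\<^sup>T\<close>, where \<open>s\<close> and \<open>t\<close> are the differences of the
  indicators of \<open>k1\<close> and \<open>k2\<close> in the first row block and in the other row blocks. These two vectors and
  their sums over the rows of the blocks span a 4-dimensional invariant subspace \<open>W\<close> of \<open>A + B\<close>, so only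
  the characteristic polynomial on \<open>W\<close> changes, from the one with roots \<open>X\<close> to the one with roots \<open>Y\<close>.
\<close>

subsection \<open>Characteristic polynomials\<close>

lemma sum_diag_mult_commute:
  fixes A B :: "'a :: comm_ring_1 mat"
  assumes "A \<in> carrier_mat n m" and "B \<in> carrier_mat m n"
  shows "(\<Sum>i<n. (A * B) $$ (i, i)) = (\<Sum>i<m. (B * A) $$ (i, i))"
proof -
  have "(\<Sum>i<n. (A * B) $$ (i, i)) = (\<Sum>i<n. \<Sum>k<m. A $$ (i, k) * B $$ (k, i))"
    using assms by (intro sum.cong) (auto simp: scalar_prod_def atLeast0LessThan)
  also have "\<dots> = (\<Sum>k<m. \<Sum>i<n. B $$ (k, i) * A $$ (i, k))"
    by (subst sum.swap) (simp add: mult.commute)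
  also have "\<dots> = (\<Sum>i<m. (B * A) $$ (i, i))"
    using assms by (intro sum.cong) (auto simp: scalar_prod_def atLeast0LessThan)
  finally show ?thesis .
qed

text \<open>A Schur triangularization of an idempotent is an idempotent triangular matrix, so its
  diagonal consists of zeros and ones and the trace counts the ones. The same similarity
  triangularizes \<open>1 + c E\<close>.\<close>

lemma det_one_plus_smult_idempotent:
  fixes E :: "complex mat"
  assumes E: "E \<in> carrier_mat n n" and idem: "E * E = E"
    and trace: "(\<Sum>i<n. E $$ (i, i)) = of_nat m"
  shows "det (1\<^sub>m n + c \<cdot>\<^sub>m E) = (1 + c) ^ m"
proof -
  obtain es where "char_poly E = (\<Prod>a\<leftarrow>es. [:- a, 1:])"
    using char_poly_factorized[OF E] by blast
  then obtain B where B: "B \<in> carrier_mat n n" and ut: "upper_triangular B" and "similar_mat E B"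
    using schur_decomposition_exists[OF E] by blast
  then obtain P Q where "similar_mat_wit E B P Q"
    unfolding similar_mat_def by blast
  note wit = similar_mat_witD2[OF E this]
  have P: "P \<in> carrier_mat n n" and Q: "Q \<in> carrier_mat n n" using wit by auto
  have EB: "E = P * (B * Q)" using wit assoc_mult_mat[OF P B Q] by simp
  have BE: "B = Q * (E * P)"
  proof -
    have "Q * (E * P) = Q * (P * (B * Q) * P)" by (simp add: EB)
    also have "\<dots> = (Q * P) * B * (Q * P)"
      using P Q B by (simp add: assoc_mult_mat[of _ n n _ n _ n])
    finally show ?thesis using wit B by simp
  qed
  have BB: "B * B = B"
  proof -
    have "B * B = Q * (E * P) * (Q * (E * P))" using BE by simp
    also have "\<dots> = Q * (E * ((P * Q) * (E * P)))"
      using P Q E by (simp add: assoc_mult_mat[of _ n n _ n _ n])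
    also have "\<dots> = Q * (E * E * P)"
      using wit P Q E by (simp add: assoc_mult_mat[of _ n n _ n _ n])
    finally show ?thesis using idem BE by simp
  qed
  \<comment> \<open>For triangular \<open>B\<close>, the diagonal of \<open>B * B\<close> holds the
    squares of the diagonal entries of \<open>B\<close>.\<close>
  have diag: "B $$ (i, i) = 0 \<or> B $$ (i, i) = 1" if i: "i < n" for i
  proof -
    have "B $$ (i, i) = (B * B) $$ (i, i)" using BB by simp
    also have "\<dots> = (\<Sum>k\<in>{0..<n}. B $$ (i, k) * B $$ (k, i))"
      using B i by (simp add: scalar_prod_def)
    also have "\<dots> = (\<Sum>k\<in>{0..<n}. if k = i then B $$ (i, i) * B $$ (i, i) else 0)"
    proof (intro sum.cong refl)
      fix k assume "k \<in> {0..<n}"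
      then show "B $$ (i, k) * B $$ (k, i) = (if k = i then B $$ (i, i) * B $$ (i, i) else 0)"
        using upper_triangularD[OF ut, of k i] upper_triangularD[OF ut, of i k] B i
        by (cases k i rule: linorder_cases) auto
    qed
    finally show ?thesis using i by simp
  qed
  have "of_nat m = (\<Sum>i<n. (P * (B * Q)) $$ (i, i))" using trace EB by simp
  also have "\<dots> = (\<Sum>i<n. (B * Q * P) $$ (i, i))"
    by (rule sum_diag_mult_commute) (use P B Q in auto)
  also have "B * Q * P = B" using wit P Q B by (simp add: assoc_mult_mat[of _ n n _ n _ n])
  finally have "of_nat m = (\<Sum>i<n. B $$ (i, i))" .
  also have "\<dots> = (\<Sum>i<n. if B $$ (i, i) = 1 then 1 else 0)"
    using diag by (intro sum.cong) auto
  also have "\<dots> = of_nat (card {i \<in> {..<n}. B $$ (i, i) = 1})"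
    by (simp add: sum.If_cases Int_def)
  finally have m: "m = card {i \<in> {..<n}. B $$ (i, i) = 1}" using of_nat_eq_iff by blast
  have "1\<^sub>m n + c \<cdot>\<^sub>m E = P * (1\<^sub>m n + c \<cdot>\<^sub>m B) * Q"
  proof -
    have "P * (1\<^sub>m n + c \<cdot>\<^sub>m B) * Q = (P * 1\<^sub>m n + P * (c \<cdot>\<^sub>m B)) * Q"
      using P B by (simp add: mult_add_distrib_mat[OF P, of _ n])
    also have "\<dots> = P * Q + c \<cdot>\<^sub>m (P * B * Q)"
      using P B Q by (simp add: add_mult_distrib_mat[of _ n n] mult_smult_distrib[OF P B]
          mult_smult_assoc_mat[of _ n n])
    finally show ?thesis using wit by simp
  qed
  then have "similar_mat (1\<^sub>m n + c \<cdot>\<^sub>m E) (1\<^sub>m n + c \<cdot>\<^sub>m B)"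
    using wit P Q B E unfolding similar_mat_def similar_mat_wit_def by (auto simp: Let_def)
  then have "det (1\<^sub>m n + c \<cdot>\<^sub>m E) = det (1\<^sub>m n + c \<cdot>\<^sub>m B)" by (rule det_similar)
  also have "\<dots> = prod_list (diag_mat (1\<^sub>m n + c \<cdot>\<^sub>m B))"
    by (rule det_upper_triangular[of _ n]) (use ut B in \<open>auto simp: upper_triangular_def\<close>)
  also have "\<dots> = (\<Prod>i<n. (1\<^sub>m n + c \<cdot>\<^sub>m B) $$ (i, i))"
    using B by (simp add: prod_list_diag_prod atLeast0LessThan)
  also have "\<dots> = (\<Prod>i<n. if B $$ (i, i) = 1 then 1 + c else 1)"
    using diag B by (intro prod.cong) auto
  also have "\<dots> = (1 + c) ^ m"
    by (simp add: prod.If_cases m Int_def)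
  finally show ?thesis .
qed

text \<open>Orthogonality kills the cross terms in the product of the factors
  \<open>1 + c p E p\<close>, so this product is the matrix in question, and its determinant is
  multiplicative.\<close>

lemma det_one_plus_sum_orthogonal_idempotents:
  fixes E :: "'p \<Rightarrow> complex mat"
  assumes "finite A" and E: "\<And>p. p \<in> A \<Longrightarrow> E p \<in> carrier_mat n n"
    and orth: "\<And>p p'. p \<in> A \<Longrightarrow> p' \<in> A \<Longrightarrow> E p * E p' = (if p = p' then E p else 0\<^sub>m n n)"
    and trace: "\<And>p. p \<in> A \<Longrightarrow> (\<Sum>i<n. E p $$ (i, i)) = of_nat (m p)"
  shows "det (mat n n (\<lambda>(i, j). (if i = j then 1 else 0) + (\<Sum>p\<in>A. c p * E p $$ (i, j))))
    = (\<Prod>p\<in>A. (1 + c p) ^ m p)"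
  using assms
proof (induction A rule: finite_induct)
  case empty
  have "mat n n (\<lambda>(i, j). if i = j then 1 else 0) = (1\<^sub>m n :: complex mat)"
    by (auto simp: one_mat_def)
  then show ?case by simp
next
  case (insert p A)
  let ?S = "\<lambda>A. mat n n (\<lambda>(i, j). (if i = j then 1 else 0) + (\<Sum>p\<in>A. c p * E p $$ (i, j)))"
  let ?F = "1\<^sub>m n + c p \<cdot>\<^sub>m E p"
  have Ep: "E p \<in> carrier_mat n n" using insert.prems by simp
  have zero: "(\<Sum>k\<in>{0..<n}. (\<Sum>p'\<in>A. c p' * E p' $$ (i, k)) * E p $$ (k, j)) = 0"
    if ij: "i < n" "j < n" for i j
  proof -
    have "(\<Sum>k\<in>{0..<n}. (\<Sum>p'\<in>A. c p' * E p' $$ (i, k)) * E p $$ (k, j))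
      = (\<Sum>p'\<in>A. c p' * (\<Sum>k\<in>{0..<n}. E p' $$ (i, k) * E p $$ (k, j)))"
      unfolding sum_distrib_right sum_distrib_left
      by (subst sum.swap) (simp add: mult.assoc)
    also have "\<dots> = (\<Sum>p'\<in>A. c p' * (E p' * E p) $$ (i, j))"
    proof (intro sum.cong refl)
      fix p' assume "p' \<in> A"
      then have "E p' \<in> carrier_mat n n" using insert.prems by simp
      then show "c p' * (\<Sum>k\<in>{0..<n}. E p' $$ (i, k) * E p $$ (k, j)) = c p' * (E p' * E p) $$ (i, j)"
        using Ep ij by (simp add: scalar_prod_def)
    qed
    also have "\<dots> = 0"
    proof (intro sum.neutral ballI)
      fix p' assume "p' \<in> A"
      then have "E p' * E p = 0\<^sub>m n n" using insert.prems(2)[of p' p] insert.hyps by auto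
      then show "c p' * (E p' * E p) $$ (i, j) = 0" using ij by simp
    qed
    finally show ?thesis .
  qed
  have "?S (insert p A) = ?S A * ?F"
  proof (rule eq_matI)
    fix i j assume "i < dim_row (?S A * ?F)" "j < dim_col (?S A * ?F)"
    then have ij: "i < n" "j < n" using Ep by auto
    have "(?S A * ?F) $$ (i, j)
      = (\<Sum>k\<in>{0..<n}. ((if i = k then 1 else 0) + (\<Sum>p\<in>A. c p * E p $$ (i, k)))
          * ((if k = j then 1 else 0) + c p * E p $$ (k, j)))"
      using ij Ep by (simp add: scalar_prod_def)
    also have "\<dots> = (\<Sum>k\<in>{0..<n}. (if i = k then (if k = j then 1 else 0) + c p * E p $$ (k, j) else 0))
        + (\<Sum>k\<in>{0..<n}. (if k = j then (\<Sum>p\<in>A. c p * E p $$ (i, k)) else 0))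
        + c p * (\<Sum>k\<in>{0..<n}. (\<Sum>p\<in>A. c p * E p $$ (i, k)) * E p $$ (k, j))"
      unfolding sum_distrib_left sum.distrib[symmetric]
      by (intro sum.cong) (auto simp: algebra_simps)
    also have "\<dots> = ?S (insert p A) $$ (i, j)"
      using ij insert.hyps by (simp add: zero)
    finally show "?S (insert p A) $$ (i, j) = (?S A * ?F) $$ (i, j)" by simp
  qed (use Ep in auto)
  then have "det (?S (insert p A)) = det (?S A) * det ?F"
    using det_mult[of "?S A" n ?F] Ep by simp
  also have "det ?F = (1 + c p) ^ m p"
    by (rule det_one_plus_smult_idempotent) (use insert.prems in auto)
  also have "det (?S A) = (\<Prod>p\<in>A. (1 + c p) ^ m p)"
    using insert.prems by (intro insert.IH) auto
  finally show ?case using insert.hyps by (simp add: mult.commute)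
qed

text \<open>Since the \<open>E p\<close> sum to 1, \<open>x - T\<close> is 1 plus the combination of
  the \<open>E p\<close> with coefficients \<open>x - \<theta> p - 1\<close>. The determinant of
  this is known for every \<open>x\<close>, which determines the polynomial.\<close>

lemma char_poly_sum_orthogonal_idempotents:
  fixes E :: "'p \<Rightarrow> complex mat"
  assumes "finite A" and E: "\<And>p. p \<in> A \<Longrightarrow> E p \<in> carrier_mat n n"
    and orth: "\<And>p p'. p \<in> A \<Longrightarrow> p' \<in> A \<Longrightarrow> E p * E p' = (if p = p' then E p else 0\<^sub>m n n)"
    and trace: "\<And>p. p \<in> A \<Longrightarrow> (\<Sum>i<n. E p $$ (i, i)) = of_nat (m p)"
    and one: "\<And>i j. i < n \<Longrightarrow> j < n \<Longrightarrow> (\<Sum>p\<in>A. E p $$ (i, j)) = (if i = j then 1 else 0)"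
    and T: "T \<in> carrier_mat n n"
      "\<And>i j. i < n \<Longrightarrow> j < n \<Longrightarrow> T $$ (i, j) = (\<Sum>p\<in>A. \<theta> p * E p $$ (i, j))"
  shows "char_poly T = (\<Prod>p\<in>A. [:- \<theta> p, 1:] ^ m p)"
proof -
  have "poly (char_poly T) x = poly (\<Prod>p\<in>A. [:- \<theta> p, 1:] ^ m p) x" for x
  proof -
    have "- char_matrix T x
      = mat n n (\<lambda>(i, j). (if i = j then 1 else 0) + (\<Sum>p\<in>A. (x - \<theta> p - 1) * E p $$ (i, j)))"
      using T by (intro eq_matI)
        (auto simp: char_matrix_def left_diff_distrib sum_subtractf one sum_distrib_left[symmetric])
    then have "poly (char_poly T) x = (\<Prod>p\<in>A. (1 + (x - \<theta> p - 1)) ^ m p)"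
      unfolding char_poly_matrix[OF T(1)]
      using det_one_plus_sum_orthogonal_idempotents[OF assms(1) E orth trace] by simp
    then show ?thesis by (simp add: poly_prod)
  qed
  then show ?thesis using poly_eq_poly_eq_iff by blast
qed

section \<open>Block triangular matrices and perturbations along an invariant subspace\<close>

lemma char_poly_four_block_upper_right_zero:
  fixes A :: "'a :: field mat"
  assumes A: "A \<in> carrier_mat n n" and C: "C \<in> carrier_mat m n" and D: "D \<in> carrier_mat m m"
  shows "char_poly (four_block_mat A (0\<^sub>m n m) C D) = char_poly A * char_poly D"
proof -
  have "char_poly_matrix (four_block_mat A (0\<^sub>m n m) C D)
    = four_block_mat (char_poly_matrix A) (0\<^sub>m n m) (map_mat (\<lambda>a. [:- a:]) C) (char_poly_matrix D)"
    using assms by (intro eq_matI) (auto simp: char_poly_matrix_def)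
  then show ?thesis unfolding char_poly_def
    using det_four_block_mat_upper_right_zero[of "char_poly_matrix A" n "0\<^sub>m n m" m
        "map_mat (\<lambda>a. [:- a:]) C" "char_poly_matrix D"] assms by simp
qed

text \<open>
  The block matrix with rows \<open>(T', 0)\<close>, \<open>(G, H)\<close> is similar to the one with rows
  \<open>(T' + W G, 0)\<close>, \<open>(G, H - G W)\<close>.
\<close>

lemma char_poly_invariant_perturbation:
  fixes T :: "'a :: field mat"
  assumes T: "T \<in> carrier_mat n n" and T': "T' \<in> carrier_mat n n"
    and W: "W \<in> carrier_mat n m" and G: "G \<in> carrier_mat m n" and H: "H \<in> carrier_mat m m"
    and inv: "T * W = W * H" and pert: "T = T' + W * G"
  shows "char_poly T' * char_poly H = char_poly T * char_poly (H - G * W)"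
proof -
  let ?S = "four_block_mat (1\<^sub>m n) W (0\<^sub>m m n) (1\<^sub>m m)"
  let ?R = "four_block_mat (1\<^sub>m n) (- W) (0\<^sub>m m n) (1\<^sub>m m)"
  let ?M = "four_block_mat T' (0\<^sub>m n m) G H"
  let ?N = "four_block_mat T (0\<^sub>m n m) G (H - G * W)"
  have K: "?S \<in> carrier_mat (n + m) (n + m)" "?R \<in> carrier_mat (n + m) (n + m)"
    "?M \<in> carrier_mat (n + m) (n + m)" "?N \<in> carrier_mat (n + m) (n + m)"
    using assms by auto
  have [simp]: "- W + W = 0\<^sub>m n m" "W + - W = 0\<^sub>m n m" "- 0\<^sub>m m m = (0\<^sub>m m m :: 'a mat)"
    using W by auto
  have SR: "?S * ?R = 1\<^sub>m (n + m)"
    using W by (subst mult_four_block_mat[of _ n n _ m _ m _ _ n _ m]) auto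
  have RS: "?R * ?S = 1\<^sub>m (n + m)"
    using W by (subst mult_four_block_mat[of _ n n _ m _ m _ _ n _ m]) auto
  have SM: "?S * ?M = four_block_mat T (W * H) G H"
    using assms by (subst mult_four_block_mat[of _ n n _ m _ m _ _ n _ m]) auto
  have NS: "?N * ?S = four_block_mat T (T * W) G H"
  proof -
    have "G * W + (H - G * W) = H" using G W H by (intro eq_matI) auto
    then show ?thesis using T W G H by (subst mult_four_block_mat[of _ n n _ m _ m _ _ n _ m]) auto
  qed
  \<comment> \<open>The upper right blocks of \<open>?S * ?M\<close> and \<open>?N * ?S\<close> are
    \<open>W * H\<close> and \<open>T * W\<close>; they agree because the columns of
    \<open>W\<close> span an invariant subspace.\<close>
  have "?R * ?N * ?S = ?R * (?S * ?M)"
    using SM NS inv K by (simp add: assoc_mult_mat[of _ "n + m" "n + m" _ "n + m" _ "n + m"])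
  also have "\<dots> = ?M"
    using RS K left_mult_one_mat[OF K(3)]
    by (simp add: assoc_mult_mat[of _ "n + m" "n + m" _ "n + m" _ "n + m", symmetric])
  finally have "similar_mat_wit ?M ?N ?R ?S"
    by (intro similar_mat_witI[OF RS SR _ K(3) K(4) K(2) K(1)]) (rule sym)
  then have "similar_mat ?M ?N" unfolding similar_mat_def by blast
  then have "char_poly ?M = char_poly ?N" by (rule char_poly_similar)
  moreover have "H - G * W \<in> carrier_mat m m" using G W by (intro minus_carrier_mat) auto
  ultimately show ?thesis
    using char_poly_four_block_upper_right_zero[OF T' G H]
      char_poly_four_block_upper_right_zero[OF T G] by simp
qed

lemma det_2x2:
  fixes A :: "'a :: comm_ring_1 mat"
  assumes "A \<in> carrier_mat 2 2"
  shows "det A = A $$ (0, 0) * A $$ (1, 1) - A $$ (0, 1) * A $$ (1, 0)"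
  using assms
  by (subst laplace_expansion_column[OF assms, of 0])
    (auto simp: numeral_2_eq_2 cofactor_def det_single mat_delete_def)

lemma char_poly_2x2:
  fixes A :: "'a :: field_char_0 mat"
  assumes A: "A \<in> carrier_mat 2 2"
  shows "char_poly A = [:A $$ (0, 0) * A $$ (1, 1) - A $$ (0, 1) * A $$ (1, 0), - A $$ (0, 0) - A $$ (1, 1), 1:]"
proof -
  have "poly (char_poly A) z = poly [:A $$ (0, 0) * A $$ (1, 1) - A $$ (0, 1) * A $$ (1, 0),
    - A $$ (0, 0) - A $$ (1, 1), 1:] z" for z
  proof -
    have "- char_matrix A z \<in> carrier_mat 2 2" using A by simp
    from det_2x2[OF this] show ?thesis
      using A unfolding char_poly_matrix[OF A] by (simp add: char_matrix_def algebra_simps)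
  qed
  then show ?thesis using poly_eq_poly_eq_iff by blast
qed

lemma replicate_mset_add: "replicate_mset (m + n) a = replicate_mset m a + replicate_mset n a"
  by (induction m) auto

subsection \<open>Averaging operators on the cells\<close>

text \<open>
  A cell is \<open>(i, j, s, t)\<close>: block row, block column, and the row and column inside the block,
  all counted from 0.
\<close>

type_synonym quad = "nat \<times> nat \<times> nat \<times> nat"

definition cells :: "nat \<Rightarrow> nat \<Rightarrow> quad set" where
  "cells q r = {..<r} \<times> {..<q} \<times> {..<q} \<times> {..<r}"

text \<open>One tensor factor of an averaging operator: the identity on a coordinate that is kept,
  the uniform mean over \<open>N\<close> values on one that is forgotten.\<close>

definition coord_kernel :: "nat \<Rightarrow> bool \<Rightarrow> nat \<Rightarrow> nat \<Rightarrow> complex" where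
  "coord_kernel N b u v = (if b then of_bool (u = v) else 1 / of_nat N)"

text \<open>The averaging operator over the cells that agree in the coordinates selected by the flags.\<close>

fun averaging :: "nat \<Rightarrow> nat \<Rightarrow> bool \<times> bool \<times> bool \<times> bool \<Rightarrow> quad \<Rightarrow> quad \<Rightarrow> complex" where
  "averaging q r (b1, b2, b3, b4) (i, j, s, t) (i', j', s', t') =
     coord_kernel r b1 i i' * coord_kernel q b2 j j' * coord_kernel q b3 s s' * coord_kernel r b4 t t'"

text \<open>Fewer kept coordinates mean a coarser partition, so the conjunction of flags describes
  the join of two partitions.\<close>

fun meet :: "bool \<times> bool \<times> bool \<times> bool \<Rightarrow> bool \<times> bool \<times> bool \<times> bool \<Rightarrow> bool \<times> bool \<times> bool \<times> bool" where
  "meet (b1, b2, b3, b4) (d1, d2, d3, d4) = (b1 \<and> d1, b2 \<and> d2, b3 \<and> d3, b4 \<and> d4)"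

section \<open>Products and traces of averaging operators in fixed coordinates\<close>

lemma finite_cells [simp]: "finite (cells q r)"
  by (simp add: cells_def)

lemma sum_cells:
  "(\<Sum>c\<in>cells q r. f c) = (\<Sum>i<r. \<Sum>j<q. \<Sum>s<q. \<Sum>t<r. f (i, j, s, t))"
  by (simp add: cells_def sum.cartesian_product')

lemma sum_cells_product:
  fixes f1 f2 f3 f4 :: "nat \<Rightarrow> complex"
  assumes "\<And>i j s t. F (i, j, s, t) = f1 i * f2 j * f3 s * f4 t"
  shows "(\<Sum>c\<in>cells q r. F c) = (\<Sum>i<r. f1 i) * (\<Sum>j<q. f2 j) * (\<Sum>s<q. f3 s) * (\<Sum>t<r. f4 t)"
  unfolding sum_cells assms
  by (simp add: sum_distrib_left[symmetric] sum_distrib_right[symmetric])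

lemma sum_coord_kernel_apply:
  assumes "u < N"
  shows "(\<Sum>v<N. coord_kernel N b u v * f v) = (if b then f u else (\<Sum>v<N. f v) / of_nat N)"
proof (cases b)
  case True
  have "(\<Sum>v<N. coord_kernel N b u v * f v) = (\<Sum>v<N. if u = v then f v else 0)"
    using True by (intro sum.cong) (auto simp: coord_kernel_def)
  then show ?thesis using True assms by simp
next
  case False
  then show ?thesis by (simp add: coord_kernel_def sum_divide_distrib)
qed

text \<open>If the left factor forgets the coordinate, only the column sums of the right factor
  remain, and these are 1 for either flag.\<close>

lemma sum_coord_kernel_mult:
  assumes "u < N" and "v < N"
  shows "(\<Sum>w<N. coord_kernel N b u w * coord_kernel N d w v) = coord_kernel N (b \<and> d) u v"
proof -
  have "(\<Sum>w<N. coord_kernel N d w v) = (1 :: complex)"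
  proof (cases d)
    case True
    have "(\<Sum>w<N. coord_kernel N d w v) = (\<Sum>w<N. if w = v then 1 else 0)"
      using True by (intro sum.cong) (auto simp: coord_kernel_def)
    then show ?thesis using assms by simp
  next
    case False
    then show ?thesis using assms by (simp add: coord_kernel_def)
  qed
  then show ?thesis
    unfolding sum_coord_kernel_apply[OF assms(1)] by (auto simp: coord_kernel_def)
qed

lemma averaging_apply:
  assumes "(i, j, s, t) \<in> cells q r"
    and F: "\<And>i j s t. F (i, j, s, t) = f1 i * f2 j * f3 s * f4 t"
  shows "(\<Sum>c\<in>cells q r. averaging q r (b1, b2, b3, b4) (i, j, s, t) c * F c)
    = (if b1 then f1 i else (\<Sum>v<r. f1 v) / of_nat r) * (if b2 then f2 j else (\<Sum>v<q. f2 v) / of_nat q)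
    * (if b3 then f3 s else (\<Sum>v<q. f3 v) / of_nat q) * (if b4 then f4 t else (\<Sum>v<r. f4 v) / of_nat r)"
proof -
  have lt: "i < r" "j < q" "s < q" "t < r" using assms(1) by (auto simp: cells_def)
  have "(\<Sum>c\<in>cells q r. averaging q r (b1, b2, b3, b4) (i, j, s, t) c * F c)
    = (\<Sum>v<r. coord_kernel r b1 i v * f1 v) * (\<Sum>v<q. coord_kernel q b2 j v * f2 v)
    * (\<Sum>v<q. coord_kernel q b3 s v * f3 v) * (\<Sum>v<r. coord_kernel r b4 t v * f4 v)"
    by (rule sum_cells_product) (simp add: F)
  then show ?thesis unfolding sum_coord_kernel_apply[OF lt(1)] sum_coord_kernel_apply[OF lt(2)]
      sum_coord_kernel_apply[OF lt(3)] sum_coord_kernel_apply[OF lt(4)] .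
qed

lemma averaging_mult:
  assumes "c \<in> cells q r" and "e \<in> cells q r"
  shows "(\<Sum>d\<in>cells q r. averaging q r b c d * averaging q r b' d e) = averaging q r (meet b b') c e"
proof -
  obtain i j s t i' j' s' t' where c: "c = (i, j, s, t)" and e: "e = (i', j', s', t')"
    by (metis prod.exhaust)
  obtain b1 b2 b3 b4 d1 d2 d3 d4 where b: "b = (b1, b2, b3, b4)" and b': "b' = (d1, d2, d3, d4)"
    by (metis prod.exhaust)
  have lt: "i < r" "j < q" "s < q" "t < r" "i' < r" "j' < q" "s' < q" "t' < r"
    using assms c e by (auto simp: cells_def)
  have "(\<Sum>d\<in>cells q r. averaging q r b c d * averaging q r b' d e)
    = (\<Sum>v<r. coord_kernel r b1 i v * coord_kernel r d1 v i') * (\<Sum>v<q. coord_kernel q b2 j v * coord_kernel q d2 v j')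
    * (\<Sum>v<q. coord_kernel q b3 s v * coord_kernel q d3 v s') * (\<Sum>v<r. coord_kernel r b4 t v * coord_kernel r d4 v t')"
    by (rule sum_cells_product) (simp add: b b' c e)
  then show ?thesis using lt by (simp add: b b' c e sum_coord_kernel_mult)
qed

lemma averaging_trace:
  assumes "0 < q" and "0 < r"
  shows "(\<Sum>c\<in>cells q r. averaging q r (b1, b2, b3, b4) c c)
    = (if b1 then of_nat r else 1) * (if b2 then of_nat q else 1)
    * (if b3 then of_nat q else 1) * (if b4 then of_nat r else 1)"
proof -
  have "(\<Sum>v<N. coord_kernel N b v v) = (if b then of_nat N else 1)" if "0 < N" for N b
    using that by (simp add: coord_kernel_def)
  moreover have "(\<Sum>c\<in>cells q r. averaging q r (b1, b2, b3, b4) c c)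
    = (\<Sum>v<r. coord_kernel r b1 v v) * (\<Sum>v<q. coord_kernel q b2 v v)
    * (\<Sum>v<q. coord_kernel q b3 v v) * (\<Sum>v<r. coord_kernel r b4 v v)"
    by (rule sum_cells_product) simp
  ultimately show ?thesis using assms by simp
qed

text \<open>
  The partitions of the cells that occur: into single cells, rows, columns, symbols, blocks, rows of
  blocks, columns of blocks, block rows, block columns, and the classes of symbols that share a row
  (\<open>XClass\<close>) or a column (\<open>YClass\<close>) of a block.
\<close>

datatype part = Fine | BRow | BCol | Row | Col | Sym | Blk | XClass | YClass | Band | Stack | Top

text \<open>The refinement order, recorded by its reflexive up-sets. For instance, a row of a block
  lies in a single \<open>XClass\<close>, and a column of a block in a single
  \<open>YClass\<close>.\<close>

fun coarser :: "part \<Rightarrow> part set" where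
  "coarser Fine = UNIV"
| "coarser BRow = {BRow, Row, Blk, XClass, Band, Stack, Top}"
| "coarser BCol = {BCol, Col, Blk, YClass, Band, Stack, Top}"
| "coarser Row = {Row, Band, Top}"
| "coarser Col = {Col, Stack, Top}"
| "coarser Sym = {Sym, XClass, YClass, Top}"
| "coarser Blk = {Blk, Band, Stack, Top}"
| "coarser XClass = {XClass, Top}"
| "coarser YClass = {YClass, Top}"
| "coarser Band = {Band, Top}"
| "coarser Stack = {Stack, Top}"
| "coarser Top = {Top}"

lemma UNIV_part: "UNIV = {Fine, BRow, BCol, Row, Col, Sym, Blk, XClass, YClass, Band, Stack, Top}"
  using part.exhaust by blast

instance part :: finite
  by standard (simp add: UNIV_part)

text \<open>The list enumerates a linear extension, so the first common coarsening is the finest one.\<close>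

definition join :: "part \<Rightarrow> part \<Rightarrow> part" where
  "join p p' = the (find (\<lambda>s. s \<in> coarser p \<inter> coarser p')
     [Fine, BRow, BCol, Row, Col, Sym, Blk, XClass, YClass, Band, Stack, Top])"

text \<open>A check of all pairs: any two partitions have a least common coarsening, and it is the
  one that \<open>join\<close> finds.\<close>

lemma coarser_join: "coarser (join p p') = coarser p \<inter> coarser p'"
  by (cases p; cases p'; simp add: join_def)

lemma coarser_refl: "p \<in> coarser p"
  by (cases p) auto

text \<open>Supplies the decreasing measure for the induction in \<open>proj_mult\<close>.\<close>

lemma card_coarser_less: "t \<in> coarser p \<Longrightarrow> t \<noteq> p \<Longrightarrow> card (coarser t) < card (coarser p)"
  by (cases p; cases t) (auto simp: UNIV_part)

text \<open>
  Coordinate systems for the cells, named by the data that determine a cell. The flags \<open>coords v p\<close>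
  mark the coordinates of \<open>v\<close> on which the partition \<open>p\<close> depends.
\<close>

datatype view = RowCol | BlkSym | RowSym | ColSym

fun coords :: "view \<Rightarrow> part \<Rightarrow> (bool \<times> bool \<times> bool \<times> bool) option" where
  "coords RowCol p = (case p of Fine \<Rightarrow> Some (True, True, True, True)
     | BRow \<Rightarrow> Some (True, True, True, False) | BCol \<Rightarrow> Some (True, True, False, True)
     | Row \<Rightarrow> Some (True, False, True, False) | Col \<Rightarrow> Some (False, True, False, True)
     | Blk \<Rightarrow> Some (True, True, False, False) | Band \<Rightarrow> Some (True, False, False, False)
     | Stack \<Rightarrow> Some (False, True, False, False) | Top \<Rightarrow> Some (False, False, False, False)
     | _ \<Rightarrow> None)"
| "coords BlkSym p = (case p of Fine \<Rightarrow> Some (True, True, True, True)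
     | BRow \<Rightarrow> Some (True, True, True, False) | BCol \<Rightarrow> Some (True, True, False, True)
     | Sym \<Rightarrow> Some (False, False, True, True) | XClass \<Rightarrow> Some (False, False, True, False)
     | YClass \<Rightarrow> Some (False, False, False, True)
     | Blk \<Rightarrow> Some (True, True, False, False) | Band \<Rightarrow> Some (True, False, False, False)
     | Stack \<Rightarrow> Some (False, True, False, False) | Top \<Rightarrow> Some (False, False, False, False)
     | _ \<Rightarrow> None)"
| "coords RowSym p = (case p of Row \<Rightarrow> Some (True, True, False, False)
     | Sym \<Rightarrow> Some (False, False, True, True) | XClass \<Rightarrow> Some (False, False, True, False)
     | YClass \<Rightarrow> Some (False, False, False, True) | Band \<Rightarrow> Some (True, False, False, False)
     | Top \<Rightarrow> Some (False, False, False, False) | _ \<Rightarrow> None)"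
| "coords ColSym p = (case p of Col \<Rightarrow> Some (True, True, False, False)
     | Sym \<Rightarrow> Some (False, False, True, True) | XClass \<Rightarrow> Some (False, False, True, False)
     | YClass \<Rightarrow> Some (False, False, False, True) | Stack \<Rightarrow> Some (False, True, False, False)
     | Top \<Rightarrow> Some (False, False, False, False) | _ \<Rightarrow> None)"

text \<open>A check of all pairs. Rows and symbols share only the view \<open>RowSym\<close>,
  columns and symbols only \<open>ColSym\<close>; the other pairs have a common view among
  \<open>RowCol\<close> and \<open>BlkSym\<close> or lie in one of these two.\<close>

lemma common_view:
  "\<exists>v b b'. coords v p = Some b \<and> coords v p' = Some b' \<and> coords v (join p p') = Some (meet b b')"
proof -
  have "\<exists>v\<in>{RowCol, BlkSym, RowSym, ColSym}. coords v p \<noteq> None \<and> coords v p' \<noteq> None \<and>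
    coords v (join p p') = Some (meet (the (coords v p)) (the (coords v p')))"
    by (cases p; cases p'; simp add: join_def ex_bool_eq)
  then show ?thesis by fastforce
qed

lemma ex_view: "\<exists>v. coords v p \<noteq> None"
  using common_view[of p p] by fastforce

text \<open>
  \<open>x i j s\<close> and \<open>y i j t\<close> are the row and the column, inside the first block, of the symbol
  in cell \<open>(i, j, s, t)\<close>; so \<open>x\<close> and \<open>y\<close> together encode the symbol.
\<close>

locale block_permutational_coordinates =
  fixes q r :: nat and x y :: "nat \<Rightarrow> nat \<Rightarrow> nat \<Rightarrow> nat"
  assumes q: "2 \<le> q" and r: "2 \<le> r"
    and x_bij: "i < r \<Longrightarrow> j < q \<Longrightarrow> bij_betw (x i j) {..<q} {..<q}"
    and y_bij: "i < r \<Longrightarrow> j < q \<Longrightarrow> bij_betw (y i j) {..<r} {..<r}"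
    and row_inj: "i < r \<Longrightarrow> s < q \<Longrightarrow> inj_on (\<lambda>(j, t). (x i j s, y i j t)) ({..<q} \<times> {..<r})"
    and col_inj: "j < q \<Longrightarrow> t < r \<Longrightarrow> inj_on (\<lambda>(i, s). (x i j s, y i j t)) ({..<r} \<times> {..<q})"
begin

lemma x_less: "i < r \<Longrightarrow> j < q \<Longrightarrow> s < q \<Longrightarrow> x i j s < q"
  using bij_betwE[OF x_bij] by auto

lemma y_less: "i < r \<Longrightarrow> j < q \<Longrightarrow> t < r \<Longrightarrow> y i j t < r"
  using bij_betwE[OF y_bij] by auto

lemma x_eq_iff: "i < r \<Longrightarrow> j < q \<Longrightarrow> s < q \<Longrightarrow> s' < q \<Longrightarrow> x i j s = x i j s' \<longleftrightarrow> s = s'"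
  using inj_on_eq_iff[OF bij_betw_imp_inj_on[OF x_bij]] by auto

lemma y_eq_iff: "i < r \<Longrightarrow> j < q \<Longrightarrow> t < r \<Longrightarrow> t' < r \<Longrightarrow> y i j t = y i j t' \<longleftrightarrow> t = t'"
  using inj_on_eq_iff[OF bij_betw_imp_inj_on[OF y_bij]] by auto

text \<open>In every view the four coordinates range over \<open>r\<close>, \<open>q\<close>,
  \<open>q\<close> and \<open>r\<close> values in this order, so each chart is a permutation of the
  same set \<open>cells q r\<close>. This is why \<open>ColSym\<close> lists \<open>t\<close> before
  \<open>j\<close>.\<close>

fun chart :: "view \<Rightarrow> quad \<Rightarrow> quad" where
  "chart RowCol (i, j, s, t) = (i, j, s, t)"
| "chart BlkSym (i, j, s, t) = (i, j, x i j s, y i j t)"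
| "chart RowSym (i, j, s, t) = (i, s, x i j s, y i j t)"
| "chart ColSym (i, j, s, t) = (t, j, x i j s, y i j t)"

text \<open>Injectivity comes from the bijections inside a block for \<open>BlkSym\<close>, and from
  the distinctness of the symbols in a row or column for \<open>RowSym\<close> and
  \<open>ColSym\<close>. An injective self-map of a finite set is onto.\<close>

lemma chart_bij: "bij_betw (chart v) (cells q r) (cells q r)"
proof -
  have "inj_on (chart v) (cells q r)"
  proof (rule inj_onI)
    fix c d assume "c \<in> cells q r" "d \<in> cells q r" and eq: "chart v c = chart v d"
    then obtain i j s t i' j' s' t' where c: "c = (i, j, s, t)" and d: "d = (i', j', s', t')"
      and lt: "i < r" "j < q" "s < q" "t < r" "i' < r" "j' < q" "s' < q" "t' < r"
      by (auto simp: cells_def)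
    show "c = d"
    proof (cases v)
      case RowCol
      then show ?thesis using eq c d by simp
    next
      case BlkSym
      then show ?thesis using eq c d lt by (auto simp: x_eq_iff y_eq_iff)
    next
      case RowSym
      then show ?thesis using eq c d lt inj_onD[OF row_inj[of i s], of "(j, t)" "(j', t')"] by auto
    next
      case ColSym
      then show ?thesis using eq c d lt inj_onD[OF col_inj[of j t], of "(i, s)" "(i', s')"] by auto
    qed
  qed
  moreover have "chart v ` cells q r \<subseteq> cells q r"
    by (cases v) (auto simp: cells_def x_less y_less)
  ultimately show ?thesis
    by (simp add: bij_betw_def endo_inj_surj)
qed

definition avg :: "part \<Rightarrow> quad \<Rightarrow> quad \<Rightarrow> complex" where
  "avg p c d = (if p \<in> {Sym, XClass, YClass}
     then averaging q r (the (coords BlkSym p)) (chart BlkSym c) (chart BlkSym d)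
     else averaging q r (the (coords RowCol p)) (chart RowCol c) (chart RowCol d))"

text \<open>Inside one block, \<open>x\<close> determines \<open>s\<close> and \<open>y\<close>
  determines \<open>t\<close>, and conversely. Hence the flags of a partition in different views
  describe the same relation between cells, with the same class size.\<close>

lemma avg_eq_averaging:
  assumes "coords v p = Some b" and "c \<in> cells q r" and "d \<in> cells q r"
  shows "avg p c d = averaging q r b (chart v c) (chart v d)"
proof -
  obtain i j s t i' j' s' t' where c: "c = (i, j, s, t)" and d: "d = (i', j', s', t')"
    and lt: "i < r" "j < q" "s < q" "t < r" "i' < r" "j' < q" "s' < q" "t' < r"
    using assms by (auto simp: cells_def)
  show ?thesis
    using assms(1) lt
    by (cases v; cases p; auto simp: c d avg_def coord_kernel_def x_eq_iff y_eq_iff)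
qed

lemma sum_chart: "(\<Sum>c\<in>cells q r. f (chart v c)) = (\<Sum>c\<in>cells q r. f c)"
  by (rule sum.reindex_bij_betw[OF chart_bij])

lemma chart_in: "c \<in> cells q r \<Longrightarrow> chart v c \<in> cells q r"
  using bij_betwE[OF chart_bij] by blast

text \<open>In a view common to both partitions and their join, the product is computed coordinate
  by coordinate; the chart only permutes the summation index.\<close>

lemma avg_mult:
  assumes "c \<in> cells q r" and "e \<in> cells q r"
  shows "(\<Sum>d\<in>cells q r. avg p c d * avg p' d e) = avg (join p p') c e"
proof -
  obtain v b b' where v: "coords v p = Some b" "coords v p' = Some b'"
    "coords v (join p p') = Some (meet b b')" using common_view by blast
  have "(\<Sum>d\<in>cells q r. avg p c d * avg p' d e)
    = (\<Sum>d\<in>cells q r. averaging q r b (chart v c) (chart v d) * averaging q r b' (chart v d) (chart v e))"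
    using assms v by (intro sum.cong) (simp_all add: avg_eq_averaging)
  also have "\<dots> = (\<Sum>d\<in>cells q r. averaging q r b (chart v c) d * averaging q r b' d (chart v e))"
    by (rule sum_chart)
  also have "\<dots> = avg (join p p') c e"
    using assms v by (simp add: averaging_mult chart_in avg_eq_averaging)
  finally show ?thesis .
qed

text \<open>The number of classes of the partition, which is the trace of its averaging
  operator.\<close>

fun avg_rank :: "part \<Rightarrow> nat" where
  "avg_rank Fine = q * q * r * r"
| "avg_rank BRow = q * q * r"
| "avg_rank BCol = q * r * r"
| "avg_rank Band = r"
| "avg_rank Stack = q"
| "avg_rank XClass = q"
| "avg_rank YClass = r"
| "avg_rank Top = 1"
| "avg_rank _ = q * r"

lemma avg_trace: "(\<Sum>c\<in>cells q r. avg p c c) = of_nat (avg_rank p)"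
proof -
  obtain v b where v: "coords v p = Some b" using ex_view by blast
  obtain b1 b2 b3 b4 where b: "b = (b1, b2, b3, b4)" by (metis prod.exhaust)
  have "(\<Sum>c\<in>cells q r. avg p c c) = (\<Sum>c\<in>cells q r. averaging q r b (chart v c) (chart v c))"
    using v by (intro sum.cong) (simp_all add: avg_eq_averaging)
  also have "\<dots> = (\<Sum>c\<in>cells q r. averaging q r b c c)"
    by (rule sum_chart[where f = "\<lambda>c. averaging q r b c c"])
  also have "\<dots> = of_nat (avg_rank p)"
    using q r v unfolding b by (subst averaging_trace; cases v; cases p; auto)
  finally show ?thesis .
qed

text \<open>Moebius inversion of \<open>avg p = (\<Sum>t\<in>coarser p. proj t)\<close>.\<close>

fun proj :: "part \<Rightarrow> quad \<Rightarrow> quad \<Rightarrow> complex" where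
  "proj Top c d = avg Top c d"
| "proj Band c d = avg Band c d - avg Top c d"
| "proj Stack c d = avg Stack c d - avg Top c d"
| "proj XClass c d = avg XClass c d - avg Top c d"
| "proj YClass c d = avg YClass c d - avg Top c d"
| "proj Row c d = avg Row c d - avg Band c d"
| "proj Col c d = avg Col c d - avg Stack c d"
| "proj Sym c d = avg Sym c d - avg XClass c d - avg YClass c d + avg Top c d"
| "proj Blk c d = avg Blk c d - avg Band c d - avg Stack c d + avg Top c d"
| "proj BRow c d = avg BRow c d - avg Row c d - avg Blk c d - avg XClass c d + avg Band c d + avg Top c d"
| "proj BCol c d = avg BCol c d - avg Col c d - avg Blk c d - avg YClass c d + avg Stack c d + avg Top c d"
| "proj Fine c d = avg Fine c d - avg BRow c d - avg BCol c d - avg Sym c d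
     + avg Blk c d + avg XClass c d + avg YClass c d - avg Top c d"

section \<open>Orthogonality and ranks of the projections\<close>

lemma avg_eq_sum_proj: "avg p c d = (\<Sum>t\<in>coarser p. proj t c d)"
  by (cases p) (simp_all add: UNIV_part)

text \<open>Expanding \<open>avg p * avg p' = avg (join p p')\<close> into projections gives one
  equation between sums over pairs of coarser partitions. By induction all pairs other than
  \<open>(p, p')\<close> contribute equally to both sides, so this last pair does too.\<close>

lemma proj_mult:
  assumes "c \<in> cells q r" and "e \<in> cells q r"
  shows "(\<Sum>d\<in>cells q r. proj p c d * proj p' d e) = (if p = p' then proj p c e else 0)"
proof (induction "card (coarser p) + card (coarser p')" arbitrary: p p' rule: less_induct)
  case less
  define X where "X t u = (\<Sum>d\<in>cells q r. proj t c d * proj u d e)" for t u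
  let ?A = "coarser p \<times> coarser p'"
  have "(\<Sum>(t, u)\<in>?A. X t u) = (\<Sum>d\<in>cells q r. avg p c d * avg p' d e)"
    unfolding X_def avg_eq_sum_proj sum_product sum.cartesian_product[symmetric]
    by (subst (3) sum.swap, subst (2) sum.swap) simp
  also have "\<dots> = (\<Sum>t\<in>coarser p \<inter> coarser p'. proj t c e)"
    by (simp add: avg_mult assms avg_eq_sum_proj[of "join p p'"] coarser_join)
  also have "\<dots> = (\<Sum>t\<in>coarser p. \<Sum>u\<in>coarser p'. if t = u then proj t c e else 0)"
    by (simp add: sum.inter_restrict)
  also have "\<dots> = (\<Sum>(t, u)\<in>?A. if t = u then proj t c e else 0)"
    by (rule sum.cartesian_product)
  finally have sums: "(\<Sum>(t, u)\<in>?A. X t u) = (\<Sum>(t, u)\<in>?A. if t = u then proj t c e else 0)" .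
  have rest: "(\<Sum>(t, u)\<in>?A - {(p, p')}. X t u) = (\<Sum>(t, u)\<in>?A - {(p, p')}. if t = u then proj t c e else 0)"
  proof (intro sum.cong refl)
    fix z assume "z \<in> ?A - {(p, p')}"
    then obtain t u where z: "z = (t, u)"
      and tu: "t \<in> coarser p" "u \<in> coarser p'" "\<not> (t = p \<and> u = p')" by auto
    have "card (coarser t) \<le> card (coarser p)" "card (coarser u) \<le> card (coarser p')"
      using card_coarser_less[OF tu(1)] card_coarser_less[OF tu(2)] by (auto simp: le_less)
    moreover have "card (coarser t) < card (coarser p) \<or> card (coarser u) < card (coarser p')"
      using tu card_coarser_less by blast
    ultimately have "card (coarser t) + card (coarser u) < card (coarser p) + card (coarser p')"
      by linarith
    then have "X t u = (if t = u then proj t c e else 0)"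
      unfolding X_def by (rule less)
    then show "(case z of (t, u) \<Rightarrow> X t u) = (case z of (t, u) \<Rightarrow> if t = u then proj t c e else 0)"
      by (simp add: z)
  qed
  have mem: "(p, p') \<in> ?A" by (simp add: coarser_refl)
  have "X p p' = (if p = p' then proj p c e else 0)"
    using sums rest sum.remove[OF _ mem, of "\<lambda>(t, u). X t u"]
      sum.remove[OF _ mem, of "\<lambda>(t, u). if t = u then proj t c e else 0"]
    by (simp del: sum.delta sum.delta')
  then show ?case by (simp add: X_def)
qed

fun mult :: "part \<Rightarrow> nat" where
  "mult Top = 1"
| "mult Band = r - 1"
| "mult Stack = q - 1"
| "mult XClass = q - 1"
| "mult YClass = r - 1"
| "mult Row = (q - 1) * r"
| "mult Col = q * (r - 1)"
| "mult Sym = (q - 1) * (r - 1)"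
| "mult Blk = (q - 1) * (r - 1)"
| "mult BRow = (q - 1) * (q * r - r - 1)"
| "mult BCol = (r - 1) * (q * r - q - 1)"
| "mult Fine = (q - 1) * (r - 1) * (q * r - 1)"

lemma proj_trace: "(\<Sum>c\<in>cells q r. proj p c c) = of_nat (mult p)"
proof -
  \<comment> \<open>With \<open>q = a + 2\<close> and \<open>r = b + 2\<close> all natural number
    subtractions in \<open>mult\<close> become polynomials in \<open>a\<close> and
    \<open>b\<close>.\<close>
  obtain a b where q: "q = a + 2" and r: "r = b + 2"
    using q r by (metis add.commute le_Suc_ex)
  have *: "q * r - r - 1 = a * b + a * 2 + b + 1" "q * r - q - 1 = a * b + b * 2 + a + 1"
    "q * r - 1 = a * b + a * 2 + b * 2 + 3" "q - 1 = a + 1" "r - 1 = b + 1"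
    by (simp_all add: q r algebra_simps)
  show ?thesis
    by (cases p; simp add: sum.distrib sum_subtractf avg_trace *; simp add: q r algebra_simps)
qed

section \<open>The spectrum for the block-permutational square\<close>

fun eigval :: "part \<Rightarrow> complex" where
  "eigval Top = 4 * of_nat q * of_nat r - of_nat q - of_nat r - 2"
| "eigval Band = 2 * of_nat q * of_nat r - of_nat q - of_nat r - 2"
| "eigval Stack = 2 * of_nat q * of_nat r - of_nat q - of_nat r - 2"
| "eigval XClass = of_nat q * of_nat r - of_nat r - 2"
| "eigval YClass = of_nat q * of_nat r - of_nat q - 2"
| "eigval Row = of_nat q * of_nat r - of_nat r - 2"
| "eigval Col = of_nat q * of_nat r - of_nat q - 2"
| "eigval Sym = of_nat q * of_nat r - 2"
| "eigval Blk = of_nat q * of_nat r - of_nat q - of_nat r - 2"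
| "eigval BRow = - of_nat r - 2"
| "eigval BCol = - of_nat q - 2"
| "eigval Fine = - 2"

text \<open>These are the entries of \<open>A + B\<close>, since an averaging operator times its
  class size is the indicator of its partition. In terms of indicators, \<open>A\<close> is
  \<open>Row + Col + Sym - 3 Fine\<close> and \<open>B\<close> is
  \<open>Blk - BRow - BCol + Fine\<close>.\<close>

definition kernel :: "quad \<Rightarrow> quad \<Rightarrow> complex" where
  "kernel c d = of_nat q * of_nat r * (avg Row c d + avg Col c d + avg Sym c d + avg Blk c d)
     - of_nat r * avg BRow c d - of_nat q * avg BCol c d - 2 * avg Fine c d"

text \<open>After expanding each \<open>avg\<close> into projections, the coefficient of
  \<open>proj p\<close> collects the coefficients of all partitions that have \<open>p\<close> among
  their coarsenings; this sum is \<open>eigval p\<close>.\<close>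

lemma kernel_eq_sum_proj: "kernel c d = (\<Sum>p\<in>UNIV. eigval p * proj p c d)"
  unfolding kernel_def UNIV_part by (simp add: algebra_simps)

lemma char_poly_kernel:
  assumes \<phi>: "bij_betw \<phi> {..<N} (cells q r)"
  shows "char_poly (mat N N (\<lambda>(a, b). kernel (\<phi> a) (\<phi> b))) = (\<Prod>p\<in>UNIV. [:- eigval p, 1:] ^ mult p)"
proof (rule char_poly_sum_orthogonal_idempotents)
  define E where "E p = mat N N (\<lambda>(a, b). proj p (\<phi> a) (\<phi> b))" for p
  have \<phi>_in: "a < N \<Longrightarrow> \<phi> a \<in> cells q r" for a
    using bij_betwE[OF \<phi>] by blast
  show "E p \<in> carrier_mat N N" for p by (simp add: E_def)
  show "E p * E p' = (if p = p' then E p else 0\<^sub>m N N)" for p p'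
  proof (rule eq_matI)
    fix a b assume "a < dim_row (if p = p' then E p else 0\<^sub>m N N)"
      "b < dim_col (if p = p' then E p else 0\<^sub>m N N)"
    then have ab: "a < N" "b < N" by (auto simp: E_def split: if_splits)
    have "(E p * E p') $$ (a, b) = (\<Sum>k<N. proj p (\<phi> a) (\<phi> k) * proj p' (\<phi> k) (\<phi> b))"
      using ab by (simp add: E_def scalar_prod_def atLeast0LessThan)
    also have "\<dots> = (\<Sum>d\<in>cells q r. proj p (\<phi> a) d * proj p' d (\<phi> b))"
      by (rule sum.reindex_bij_betw[OF \<phi>])
    finally show "(E p * E p') $$ (a, b) = (if p = p' then E p else 0\<^sub>m N N) $$ (a, b)"
      using ab by (simp add: proj_mult \<phi>_in E_def)
  qed (auto simp: E_def)
  show "(\<Sum>a<N. E p $$ (a, a)) = of_nat (mult p)" for p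
  proof -
    have "(\<Sum>a<N. E p $$ (a, a)) = (\<Sum>a<N. proj p (\<phi> a) (\<phi> a))" by (simp add: E_def)
    also have "\<dots> = (\<Sum>c\<in>cells q r. proj p c c)"
      by (rule sum.reindex_bij_betw[OF \<phi>, of "\<lambda>c. proj p c c"])
    finally show ?thesis by (simp add: proj_trace)
  qed
  show "(\<Sum>p\<in>UNIV. E p $$ (a, b)) = (if a = b then 1 else 0)" if "a < N" "b < N" for a b
  proof -
    obtain i j s t i' j' s' t' where c: "\<phi> a = (i, j, s, t)" and d: "\<phi> b = (i', j', s', t')"
      by (metis prod.exhaust)
    \<comment> \<open>Every partition is coarser than \<open>Fine\<close>, so all projections
      together give the average over single cells, which is the identity.\<close>
    have "(\<Sum>p\<in>UNIV. E p $$ (a, b)) = avg Fine (\<phi> a) (\<phi> b)"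
      using that by (simp add: E_def avg_eq_sum_proj)
    also have "\<dots> = of_bool (\<phi> a = \<phi> b)"
      unfolding c d by (auto simp: avg_def coord_kernel_def)
    finally show ?thesis
      using inj_on_eq_iff[OF bij_betw_imp_inj_on[OF \<phi>], of a b] that by simp
  qed
  show "mat N N (\<lambda>(a, b). kernel (\<phi> a) (\<phi> b)) $$ (a, b) = (\<Sum>p\<in>UNIV. eigval p * E p $$ (a, b))"
    if "a < N" "b < N" for a b
    using that by (simp add: E_def kernel_eq_sum_proj)
qed auto

end

subsection \<open>The invariant subspace\<close>

context block_permutational_coordinates
begin

text \<open>The map that sends \<open>f\<close> to the constant \<open>q * (sum of f)\<close> minus
  \<open>2 f\<close>, in the basis of the indicators of \<open>i = 0\<close> and
  \<open>i \<noteq> 0\<close> among the \<open>r\<close> block rows.\<close>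

definition restriction :: "complex mat" where
  "restriction = mat 2 2 (\<lambda>(k, l). of_nat q * (if l = 0 then 1 else of_nat r - 1) - (if k = l then 2 else 0))"

text \<open>The inner products of \<open>swap_rest\<close> (row 0) and \<open>swap_top\<close> (row
  1) with \<open>basis 0\<close> and \<open>basis 1\<close>, and equally with \<open>basis 2\<close>
  and \<open>basis 3\<close>.\<close>

definition twist :: "complex mat" where
  "twist = mat 2 2 (\<lambda>(k, l). if k = l then 0 else 2 * of_nat q * (if l = 0 then 1 else of_nat r - 1))"

text \<open>In the first block the two interchanged symbols stand in the rows \<open>x1\<close> and
  \<open>x2\<close> of the common column \<open>y0\<close>, all counted from 0.\<close>

context
  fixes x1 x2 y0 :: nat
  assumes x12: "x1 < q" "x2 < q" "x1 \<noteq> x2" and y0: "y0 < r"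
begin

definition sgn_x :: "nat \<Rightarrow> complex" where
  "sgn_x u = of_bool (u = x1) - of_bool (u = x2)"

text \<open>A product function in the coordinates \<open>BlkSym\<close> that does not depend on
  \<open>j\<close>. All vectors of the invariant subspace are combinations of such
  functions.\<close>

fun direction :: "(nat \<Rightarrow> complex) \<Rightarrow> (nat \<Rightarrow> complex) \<Rightarrow> quad \<Rightarrow> complex" where
  "direction f g (i, j, s, t) = f i * sgn_x (x i j s) * g (y i j t)"

lemma sum_sgn_x: "(\<Sum>u<q. sgn_x u) = 0" "(\<Sum>u<q. sgn_x u * sgn_x u) = 2"
proof -
  have "(\<Sum>u<q. of_bool (u = v)) = (1 :: complex)" if "v < q" for v
    using that by (simp add: of_bool_def)
  then show "(\<Sum>u<q. sgn_x u) = 0"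
    using x12 by (simp add: sgn_x_def sum_subtractf)
  have "sgn_x u * sgn_x u = of_bool (u = x1) + of_bool (u = x2)" for u
    using x12 by (auto simp: sgn_x_def)
  then show "(\<Sum>u<q. sgn_x u * sgn_x u) = 2"
    using x12 \<open>\<And>v. v < q \<Longrightarrow> _\<close> by (simp add: sum.distrib)
qed

lemma sum_direction_mult:
  "(\<Sum>c\<in>cells q r. direction f g c * direction f' g' c)
    = 2 * of_nat q * (\<Sum>i<r. f i * f' i) * (\<Sum>t<r. g t * g' t)"
proof -
  define F where "F = (\<lambda>(i, j :: nat, s, t). (f i * f' i) * 1 * (sgn_x s * sgn_x s) * (g t * g' t))"
  have "(\<Sum>c\<in>cells q r. direction f g c * direction f' g' c) = (\<Sum>c\<in>cells q r. F (chart BlkSym c))"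
    by (intro sum.cong) (auto simp: F_def cells_def)
  also have "\<dots> = (\<Sum>c\<in>cells q r. F c)" by (rule sum_chart)
  also have "\<dots> = (\<Sum>i<r. f i * f' i) * (\<Sum>j<q. 1) * (\<Sum>s<q. sgn_x s * sgn_x s) * (\<Sum>t<r. g t * g' t)"
    by (rule sum_cells_product) (simp add: F_def)
  finally show ?thesis by (simp add: sum_sgn_x)
qed

text \<open>In both views the function is a product that is constant in the second coordinate.
  Averaging over the third coordinate, which is \<open>x\<close>, gives 0 because
  \<open>sgn_x\<close> sums to 0.\<close>

lemma avg_direction:
  assumes c: "(i, j, s, t) \<in> cells q r" and v: "v = BlkSym \<or> v = RowSym"
    and p: "coords v p = Some (b1, b2, b3, b4)"
  shows "(\<Sum>d\<in>cells q r. avg p (i, j, s, t) d * direction f g d)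
    = (if b1 then f i else (\<Sum>i<r. f i) / of_nat r) * (if b3 then sgn_x (x i j s) else 0)
    * (if b4 then g (y i j t) else (\<Sum>t<r. g t) / of_nat r)"
proof -
  define F where "F = (\<lambda>(i, j :: nat, s, t). f i * 1 * sgn_x s * g t)"
  obtain i' j' s' t' where c': "chart v (i, j, s, t) = (i', j', s', t')" by (metis prod.exhaust)
  then have eqs: "i' = i" "s' = x i j s" "t' = y i j t" using v by auto
  have "(\<Sum>d\<in>cells q r. avg p (i, j, s, t) d * direction f g d)
    = (\<Sum>d\<in>cells q r. averaging q r (b1, b2, b3, b4) (i', j', s', t') (chart v d) * F (chart v d))"
    using v c p by (intro sum.cong) (auto simp: F_def avg_eq_averaging c' cells_def)
  also have "\<dots> = (\<Sum>d\<in>cells q r. averaging q r (b1, b2, b3, b4) (i', j', s', t') d * F d)"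
    by (rule sum_chart)
  also have "\<dots> = (if b1 then f i else (\<Sum>v<r. f v) / of_nat r)
    * (if b2 then 1 else (\<Sum>v<q. 1) / of_nat q)
    * (if b3 then sgn_x s' else (\<Sum>v<q. sgn_x v) / of_nat q)
    * (if b4 then g t' else (\<Sum>v<r. g v) / of_nat r)"
    unfolding eqs(1)[symmetric]
    by (rule averaging_apply) (use chart_in[OF c, of v] c' in \<open>auto simp: F_def\<close>)
  finally show ?thesis using q by (simp add: eqs sum_sgn_x)
qed

text \<open>The coordinates \<open>ColSym\<close> do not contain \<open>i\<close>, so the function
  need not be a product there. Instead, averaging over a column factors through averaging over the
  columns of blocks, which already gives 0.\<close>

lemma avg_Col_direction:
  assumes c: "c \<in> cells q r"
  shows "(\<Sum>d\<in>cells q r. avg Col c d * direction f g d) = 0"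
proof -
  have "(\<Sum>d\<in>cells q r. avg Col c d * direction f g d)
    = (\<Sum>d\<in>cells q r. (\<Sum>e\<in>cells q r. avg Col c e * avg BCol e d) * direction f g d)"
    using c by (intro sum.cong) (simp_all add: avg_mult join_def)
  also have "\<dots> = (\<Sum>e\<in>cells q r. avg Col c e * (\<Sum>d\<in>cells q r. avg BCol e d * direction f g d))"
    unfolding sum_distrib_left sum_distrib_right by (subst sum.swap) (simp add: mult.assoc)
  also have "\<dots> = 0"
  proof (intro sum.neutral ballI)
    fix e assume e: "e \<in> cells q r"
    obtain i j s t where "e = (i, j, s, t)" by (metis prod.exhaust)
    then show "avg Col c e * (\<Sum>d\<in>cells q r. avg BCol e d * direction f g d) = 0"
      using e by (simp add: avg_direction[of _ _ _ _ BlkSym BCol True True False True])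
  qed
  finally show ?thesis .
qed

text \<open>Only \<open>Sym\<close>, \<open>BRow\<close> and \<open>Fine\<close> keep the coordinate
  \<open>x\<close>; the contributions of \<open>Row\<close>, \<open>Col\<close>, \<open>Blk\<close>
  and \<open>BCol\<close> vanish.\<close>

lemma kernel_direction:
  assumes c: "(i, j, s, t) \<in> cells q r"
  shows "(\<Sum>d\<in>cells q r. kernel (i, j, s, t) d * direction f g d)
    = (of_nat q * (\<Sum>i<r. f i) * g (y i j t) - (\<Sum>t<r. g t) * f i - 2 * f i * g (y i j t)) * sgn_x (x i j s)"
proof -
  have "(\<Sum>d\<in>cells q r. kernel (i, j, s, t) d * direction f g d)
    = of_nat q * of_nat r * ((\<Sum>d\<in>cells q r. avg Row (i, j, s, t) d * direction f g d)
        + (\<Sum>d\<in>cells q r. avg Col (i, j, s, t) d * direction f g d)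
        + (\<Sum>d\<in>cells q r. avg Sym (i, j, s, t) d * direction f g d)
        + (\<Sum>d\<in>cells q r. avg Blk (i, j, s, t) d * direction f g d))
      - of_nat r * (\<Sum>d\<in>cells q r. avg BRow (i, j, s, t) d * direction f g d)
      - of_nat q * (\<Sum>d\<in>cells q r. avg BCol (i, j, s, t) d * direction f g d)
      - 2 * (\<Sum>d\<in>cells q r. avg Fine (i, j, s, t) d * direction f g d)"
    unfolding sum_distrib_left sum.distrib[symmetric] sum_subtractf[symmetric] kernel_def
    by (intro sum.cong) (simp_all add: algebra_simps)
  also have "\<dots> = of_nat q * of_nat r * ((\<Sum>i<r. f i) / of_nat r * sgn_x (x i j s) * g (y i j t))
      - of_nat r * (f i * sgn_x (x i j s) * ((\<Sum>t<r. g t) / of_nat r))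
      - 2 * (f i * sgn_x (x i j s) * g (y i j t))"
    by (simp add: avg_Col_direction[OF c]
        avg_direction[OF c, of RowSym Row True True False False] avg_direction[OF c, of BlkSym Sym False False True True]
        avg_direction[OF c, of BlkSym Blk True True False False] avg_direction[OF c, of BlkSym BRow True True True False]
        avg_direction[OF c, of BlkSym BCol True True False True] avg_direction[OF c, of BlkSym Fine True True True True])
  also have "\<dots> = (of_nat q * (\<Sum>i<r. f i) * g (y i j t) - (\<Sum>t<r. g t) * f i - 2 * f i * g (y i j t)) * sgn_x (x i j s)"
    using r by (simp add: field_simps)
  finally show ?thesis .
qed

section \<open>The perturbation by the interchange and its invariant subspace\<close>

definition swap_top :: "quad \<Rightarrow> complex" where
  "swap_top = direction (\<lambda>i. of_bool (i = 0)) (\<lambda>t. of_bool (t = y0))"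

definition swap_rest :: "quad \<Rightarrow> complex" where
  "swap_rest = direction (\<lambda>i. of_bool (i \<noteq> 0)) (\<lambda>t. of_bool (t = y0))"

text \<open>Interchanging the symbols in both of two cells, or in neither, does not affect whether
  the symbols agree. So only pairs of a cell in the first block row and a cell outside it
  change.\<close>

definition swapped_kernel :: "quad \<Rightarrow> quad \<Rightarrow> complex" where
  "swapped_kernel c d = kernel c d - swap_top c * swap_rest d - swap_rest c * swap_top d"

text \<open>\<open>basis 0\<close> and \<open>basis 1\<close> are \<open>swap_top\<close> and
  \<open>swap_rest\<close>. Each row of a block has exactly one cell with \<open>y = y0\<close>, so
  dropping that condition in \<open>basis 2\<close> and \<open>basis 3\<close> gives the sums over
  the rows of the blocks.\<close>

fun basis :: "nat \<Rightarrow> quad \<Rightarrow> complex" where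
  "basis k = direction (\<lambda>i. of_bool (if even k then i = 0 else i \<noteq> 0)) (\<lambda>t. of_bool (k < 2 \<longrightarrow> t = y0))"

lemma card_nonzero_less: "of_nat (card ({..<r} \<inter> Collect ((<) 0))) = (of_nat r - 1 :: complex)"
proof -
  have "{..<r} \<inter> Collect ((<) 0) = {1..<r}" by auto
  then show ?thesis using r by (simp add: of_nat_diff)
qed

text \<open>An instance of \<open>char_poly_invariant_perturbation\<close>: the two small matrices
  are the actions of the original and of the perturbed operator on the span of the
  \<open>basis\<close> functions.\<close>

lemma char_poly_swapped_kernel:
  assumes \<phi>: "bij_betw \<phi> {..<N} (cells q r)"
  shows "char_poly (mat N N (\<lambda>(a, b). swapped_kernel (\<phi> a) (\<phi> b)))
      * char_poly (four_block_mat restriction (0\<^sub>m 2 2) (- 1\<^sub>m 2) (restriction - of_nat r \<cdot>\<^sub>m 1\<^sub>m 2))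
    = char_poly (mat N N (\<lambda>(a, b). kernel (\<phi> a) (\<phi> b)))
      * char_poly (four_block_mat (restriction - twist) (- twist) (- 1\<^sub>m 2) (restriction - of_nat r \<cdot>\<^sub>m 1\<^sub>m 2))"
proof -
  let ?T = "mat N N (\<lambda>(a, b). kernel (\<phi> a) (\<phi> b))"
  let ?T' = "mat N N (\<lambda>(a, b). swapped_kernel (\<phi> a) (\<phi> b))"
  let ?H = "four_block_mat restriction (0\<^sub>m 2 2) (- 1\<^sub>m 2) (restriction - of_nat r \<cdot>\<^sub>m 1\<^sub>m 2)"
  let ?H' = "four_block_mat (restriction - twist) (- twist) (- 1\<^sub>m 2) (restriction - of_nat r \<cdot>\<^sub>m 1\<^sub>m 2)"
  define W where "W = mat N 4 (\<lambda>(a, k). basis k (\<phi> a))"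
  \<comment> \<open>The first two rows are in the order opposite to the columns of \<open>W\<close>,
    so \<open>W * G\<close> is the symmetric sum of the two mixed products of
    \<open>swap_top\<close> and \<open>swap_rest\<close>.\<close>
  define G where "G = mat 4 N (\<lambda>(k, a). if k = 0 then swap_rest (\<phi> a) else if k = 1 then swap_top (\<phi> a) else 0)"
  have \<phi>_in: "a < N \<Longrightarrow> \<phi> a \<in> cells q r" for a
    using bij_betwE[OF \<phi>] by blast
  have upt4: "{0..<4} = {0, 1, 2, 3 :: nat}" by auto
  have lt4: "k < 4 \<Longrightarrow> k = 0 \<or> k = 1 \<or> k = 2 \<or> k = 3" for k :: nat by auto
  have W: "W \<in> carrier_mat N 4" and G: "G \<in> carrier_mat 4 N" by (simp_all add: W_def G_def)
  have R: "restriction \<in> carrier_mat 2 2" and Z: "twist \<in> carrier_mat 2 2"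
    by (simp_all add: restriction_def twist_def)
  have R': "restriction - of_nat r \<cdot>\<^sub>m 1\<^sub>m 2 \<in> carrier_mat 2 2"
    by (intro minus_carrier_mat) simp
  have H: "?H \<in> carrier_mat 4 4"
    using four_block_carrier_mat[OF R R'] by simp
  have TW: "?T * W = W * ?H"
  proof (rule eq_matI)
    fix a k assume "a < dim_row (W * ?H)" "k < dim_col (W * ?H)"
    then have a: "a < N" and k: "k < 4" using W H by auto
    obtain i j s t where c: "\<phi> a = (i, j, s, t)" by (metis prod.exhaust)
    let ?f = "\<lambda>i. of_bool (if even k then i = 0 else i \<noteq> 0) :: complex"
    let ?g = "\<lambda>t. of_bool (k < 2 \<longrightarrow> t = y0) :: complex"
    have "(?T * W) $$ (a, k) = (\<Sum>b<N. kernel (\<phi> a) (\<phi> b) * basis k (\<phi> b))"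
      using a k by (simp add: W_def scalar_prod_def atLeast0LessThan)
    also have "\<dots> = (\<Sum>d\<in>cells q r. kernel (\<phi> a) d * basis k d)"
      by (rule sum.reindex_bij_betw[OF \<phi>])
    also have "\<dots> = (of_nat q * (\<Sum>i<r. ?f i) * ?g (y i j t) - (\<Sum>t<r. ?g t) * ?f i - 2 * ?f i * ?g (y i j t))
        * sgn_x (x i j s)"
      unfolding c basis.simps by (rule kernel_direction) (use \<phi>_in[OF a] c in simp)
    \<comment> \<open>The constant 1 is the sum of the indicators of \<open>i = 0\<close> and
      \<open>i \<noteq> 0\<close>, which yields \<open>restriction\<close>. The term with the sum of
      \<open>?g\<close> is a multiple of a row sum vector: its coefficient is -1 for
      \<open>k < 2\<close> and \<open>- r\<close> otherwise.\<close>
    also have "\<dots> = (W * ?H) $$ (a, k)"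
      using lt4[OF k] a R r y0 c
      by (elim disjE) (simp_all add: W_def scalar_prod_def upt4 restriction_def
          card_nonzero_less algebra_simps)
    finally show "(?T * W) $$ (a, k) = (W * ?H) $$ (a, k)" .
  qed (use W H in auto)
  have T: "?T = ?T' + W * G"
    by (intro eq_matI) (auto simp: W_def G_def scalar_prod_def upt4 swapped_kernel_def swap_top_def swap_rest_def
        algebra_simps)
  have GW: "(G * W) $$ (k, l) = (if k = 0 then \<Sum>c\<in>cells q r. swap_rest c * basis l c
      else if k = 1 then \<Sum>c\<in>cells q r. swap_top c * basis l c else 0)" if "k < 4" "l < 4" for k l
  proof -
    have "(G * W) $$ (k, l) = (\<Sum>a<N. (if k = 0 then swap_rest (\<phi> a) else if k = 1 then swap_top (\<phi> a) else 0) * basis l (\<phi> a))"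
      using that by (simp add: W_def G_def scalar_prod_def atLeast0LessThan)
    also have "\<dots> = (\<Sum>c\<in>cells q r. (if k = 0 then swap_rest c else if k = 1 then swap_top c else 0) * basis l c)"
      by (rule sum.reindex_bij_betw[OF \<phi>])
    finally show ?thesis by simp
  qed
  have bools: "of_bool P * of_bool Q = (of_bool (P \<and> Q) :: complex)" for P Q by simp
  \<comment> \<open>The swap vectors live on \<open>y = y0\<close>, so they have the same inner
    products with \<open>basis l\<close> and \<open>basis (l + 2)\<close>. Hence
    \<open>twist\<close> fills both upper blocks of \<open>G * W\<close>.\<close>
  have HGW: "?H - G * W = ?H'"
  proof (rule eq_matI)
    fix k l assume "k < dim_row ?H'" "l < dim_col ?H'"
    then have kl: "k < 4" "l < 4" using R Z by auto
    have "(?H - G * W) $$ (k, l) = ?H $$ (k, l) - (G * W) $$ (k, l)"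
      using kl H G W by auto
    also have "\<dots> = ?H' $$ (k, l)"
      unfolding GW[OF kl]
      using lt4[OF kl(1)] lt4[OF kl(2)] R Z r y0
      by (elim disjE) (simp_all add: swap_top_def swap_rest_def sum_direction_mult restriction_def twist_def
          card_nonzero_less bools[symmetric] del: of_bool_conj)
    finally show "(?H - G * W) $$ (k, l) = ?H' $$ (k, l)" .
  qed (use G W H R Z in auto)
  show ?thesis
    using char_poly_invariant_perturbation[OF _ _ W G H TW T] unfolding HGW by simp
qed

end

end

section \<open>Characteristic polynomials on the invariant subspace\<close>

context block_permutational_coordinates
begin

lemma restriction_carrier: "restriction \<in> carrier_mat 2 2" and twist_carrier: "twist \<in> carrier_mat 2 2"
  and restriction_shifted_carrier: "restriction - of_nat r \<cdot>\<^sub>m 1\<^sub>m 2 \<in> carrier_mat 2 2"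
  by (auto simp: restriction_def twist_def intro!: minus_carrier_mat)

text \<open>The roots are the members of \<open>X\<close>: the roots -2 and \<open>q r - 2\<close>
  of \<open>restriction\<close>, and the same two shifted by \<open>- r\<close>.\<close>

lemma char_poly_restriction:
  "char_poly (four_block_mat restriction (0\<^sub>m 2 2) (- 1\<^sub>m 2) (restriction - of_nat r \<cdot>\<^sub>m 1\<^sub>m 2))
    = [:2, 1:] * [:of_nat r + 2, 1:] * [:2 - of_nat q * of_nat r, 1:] * [:of_nat r + 2 - of_nat q * of_nat r, 1:]"
proof -
  have "char_poly restriction = [:2, 1:] * [:2 - of_nat q * of_nat r, 1:]"
    by (subst char_poly_2x2[OF restriction_carrier]) (simp add: restriction_def algebra_simps)
  moreover have "char_poly (restriction - of_nat r \<cdot>\<^sub>m 1\<^sub>m 2)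
      = [:of_nat r + 2, 1:] * [:of_nat r + 2 - of_nat q * of_nat r, 1:]"
    by (subst char_poly_2x2[OF restriction_shifted_carrier]) (simp add: restriction_def algebra_simps)
  ultimately show ?thesis
    using char_poly_four_block_upper_right_zero[OF restriction_carrier _ restriction_shifted_carrier, of "- 1\<^sub>m 2"]
    by (simp add: ac_simps del: mult_pCons_left mult_pCons_right)
qed

text \<open>\<open>w / 2\<close> is the distance of \<open>z\<close> from the mean of the four
  roots. In this variable the quartic contains only even powers, so it is solved by nested square
  roots.\<close>

lemma poly_char_poly_twisted:
  fixes z :: complex
  defines "w \<equiv> 2 * z + 4 - (of_nat q - 1) * of_nat r"
  shows "poly (char_poly (four_block_mat (restriction - twist) (- twist) (- 1\<^sub>m 2)
      (restriction - of_nat r \<cdot>\<^sub>m 1\<^sub>m 2))) z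
    = ((w\<^sup>2 - ((of_nat q)\<^sup>2 + 1) * (of_nat r)\<^sup>2)\<^sup>2
      - (2 * of_nat q * (of_nat r - 2))\<^sup>2 * ((of_nat r)\<^sup>2 + 4 * of_nat r - 4)) / 16"
proof -
  let ?H = "four_block_mat (restriction - twist) (- twist) (- 1\<^sub>m 2) (restriction - of_nat r \<cdot>\<^sub>m 1\<^sub>m 2)"
  define A where "A = z \<cdot>\<^sub>m 1\<^sub>m 2 - (restriction - twist)"
  define D where "D = z \<cdot>\<^sub>m 1\<^sub>m 2 - (restriction - of_nat r \<cdot>\<^sub>m 1\<^sub>m 2)"
  have RZ: "restriction - twist \<in> carrier_mat 2 2"
    by (intro minus_carrier_mat twist_carrier)
  have A: "A \<in> carrier_mat 2 2" and D: "D \<in> carrier_mat 2 2"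
    unfolding A_def D_def by (intro minus_carrier_mat RZ restriction_shifted_carrier)+
  have H: "?H \<in> carrier_mat 4 4"
    using four_block_carrier_mat[OF RZ restriction_shifted_carrier] by simp
  have "- char_matrix ?H z = four_block_mat A twist (1\<^sub>m 2) D"
    using A D twist_carrier restriction_carrier
    by (intro eq_matI) (auto simp: char_matrix_def A_def D_def)
  then have "poly (char_poly ?H) z = det (four_block_mat A twist (1\<^sub>m 2) D)"
    unfolding char_poly_matrix[OF H] by simp
  \<comment> \<open>The lower left block is the identity and commutes with \<open>D\<close>, which
    reduces the determinant to size 2.\<close>
  also have "\<dots> = det (A * D - twist * 1\<^sub>m 2)"
    using A D twist_carrier by (intro det_four_block_mat[of _ 2]) auto
  also have "twist * 1\<^sub>m 2 = twist" using twist_carrier by simp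
  also have "det (A * D - twist) = (A * D - twist) $$ (0, 0) * (A * D - twist) $$ (1, 1)
      - (A * D - twist) $$ (0, 1) * (A * D - twist) $$ (1, 0)"
    by (rule det_2x2) (intro minus_carrier_mat twist_carrier)
  finally have det: "poly (char_poly ?H) z = \<dots>" .
  have AD: "(A * D - twist) $$ (k, l) = A $$ (k, 0) * D $$ (0, l) + A $$ (k, 1) * D $$ (1, l) - twist $$ (k, l)"
    if "k < 2" "l < 2" for k l
  proof -
    have "{0..<2} = {0, 1 :: nat}" by auto
    then show ?thesis using A D twist_carrier that by (simp add: scalar_prod_def)
  qed
  have lt: "0 < (2 :: nat)" "1 < (2 :: nat)" by simp_all
  have A_entries: "A $$ (0, 0) = z + 2 - of_nat q" "A $$ (0, 1) = of_nat q * (of_nat r - 1)"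
    "A $$ (1, 0) = of_nat q" "A $$ (1, 1) = z + 2 - of_nat q * (of_nat r - 1)"
    by (simp_all add: A_def restriction_def twist_def)
  have D_entries: "D $$ (0, 0) = z + 2 + of_nat r - of_nat q" "D $$ (0, 1) = - of_nat q * (of_nat r - 1)"
    "D $$ (1, 0) = - of_nat q" "D $$ (1, 1) = z + 2 + of_nat r - of_nat q * (of_nat r - 1)"
    by (simp_all add: D_def restriction_def)
  have twist_entries: "twist $$ (0, 0) = 0" "twist $$ (0, 1) = 2 * of_nat q * (of_nat r - 1)"
    "twist $$ (1, 0) = 2 * of_nat q" "twist $$ (1, 1) = 0"
    by (simp_all add: twist_def)
  show ?thesis
    unfolding det w_def AD[OF lt(1) lt(1)] AD[OF lt(1) lt(2)] AD[OF lt(2) lt(1)] AD[OF lt(2) lt(2)]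
      A_entries D_entries twist_entries
    by (simp add: field_simps power2_eq_square)
qed

text \<open>The quartic is a difference of squares and splits twice. Most of the work is to show
  that both radicands are nonnegative, so that the real square roots are genuine.\<close>

lemma char_poly_twisted:
  fixes \<theta> :: "real \<Rightarrow> real \<Rightarrow> real"
  defines "\<theta> \<equiv> \<lambda>e1 e2. 1/2 * ((real q - 1) * real r - 4 + e1 * sqrt (((real q)\<^sup>2 + 1) * (real r)\<^sup>2
             + e2 * (2 * real q * (real r - 2) * sqrt ((real r)\<^sup>2 + 4 * real r - 4))))"
  shows "char_poly (four_block_mat (restriction - twist) (- twist) (- 1\<^sub>m 2)
      (restriction - of_nat r \<cdot>\<^sub>m 1\<^sub>m 2))
    = [:- of_real (\<theta> 1 1), 1:] * [:- of_real (\<theta> 1 (- 1)), 1:] * [:- of_real (\<theta> (- 1) 1), 1:]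
      * [:- of_real (\<theta> (- 1) (- 1)), 1:]" (is "?p = ?q")
proof -
  define S where "S = sqrt ((real r)\<^sup>2 + 4 * real r - 4)"
  define A where "A = ((real q)\<^sup>2 + 1) * (real r)\<^sup>2"
  define K where "K = 2 * real q * (real r - 2) * S"
  have r': "real r \<ge> 2" using r by simp
  then have "0 \<le> (real r)\<^sup>2 + 4 * real r - 4" using zero_le_power2[of "real r"] by linarith
  then have S2: "S\<^sup>2 = (real r)\<^sup>2 + 4 * real r - 4" and S0: "0 \<le> S" by (simp_all add: S_def)
  \<comment> \<open>With \<open>r * r - (4 r - 4)\<close> for the square of \<open>r - 2\<close>,
    the product is again a difference of squares; hence \<open>(r - 2) S\<close> is at most the
    square of \<open>r\<close>.\<close>
  have "((real r - 2) * S)\<^sup>2 = ((real r)\<^sup>2)\<^sup>2 - (4 * real r - 4)\<^sup>2"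
    unfolding power_mult_distrib S2 by (simp add: power2_eq_square algebra_simps)
  then have "((real r - 2) * S)\<^sup>2 \<le> ((real r)\<^sup>2)\<^sup>2" by simp
  then have "(real r - 2) * S \<le> (real r)\<^sup>2" by (rule power2_le_imp_le) simp
  then have "2 * real q * ((real r - 2) * S) \<le> 2 * real q * (real r)\<^sup>2"
    by (intro mult_left_mono) auto
  moreover have "0 \<le> (real q - 1)\<^sup>2 * (real r)\<^sup>2" by simp
  then have "2 * real q * (real r)\<^sup>2 \<le> A"
    by (simp add: A_def power2_eq_square algebra_simps)
  ultimately have "K \<le> A" by (simp add: K_def)
  moreover have "0 \<le> K" using r' S0 by (simp add: K_def)
  ultimately have nonneg: "0 \<le> A + K" "0 \<le> A - K" by auto
  define u where "u = complex_of_real (sqrt (A + K))"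
  define v where "v = complex_of_real (sqrt (A - K))"
  have u2: "u\<^sup>2 = of_real (A + K)" and v2: "v\<^sup>2 = of_real (A - K)"
    using nonneg by (simp_all add: u_def v_def flip: of_real_power)
  have \<theta>: "of_real (\<theta> e 1) = 1/2 * ((of_nat q - 1) * of_nat r - 4 + of_real e * u)"
    "of_real (\<theta> e (- 1)) = 1/2 * ((of_nat q - 1) * of_nat r - 4 + of_real e * v)" for e
    by (simp_all add: \<theta>_def u_def v_def A_def K_def S_def)
  have "poly ?p z = poly ?q z" for z
  proof -
    let ?w = "2 * z + 4 - (of_nat q - 1) * of_nat r"
    have "poly ?q z = (?w\<^sup>2 - u\<^sup>2) * (?w\<^sup>2 - v\<^sup>2) / 16"
      by (simp add: \<theta> power2_eq_square field_simps)
    also have "\<dots> = ((?w\<^sup>2 - of_real A)\<^sup>2 - of_real (K\<^sup>2)) / 16"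
      unfolding u2 v2 by (simp add: power2_eq_square algebra_simps)
    also have "K\<^sup>2 = (2 * real q * (real r - 2))\<^sup>2 * ((real r)\<^sup>2 + 4 * real r - 4)"
      unfolding K_def power_mult_distrib S2 ..
    also have "((?w\<^sup>2 - of_real A)\<^sup>2 - of_real \<dots>) / 16 = poly ?p z"
      unfolding poly_char_poly_twisted A_def by simp
    finally show ?thesis ..
  qed
  then show ?thesis using poly_eq_poly_eq_iff by blast
qed

lemma kernel_entry:
  "kernel (i, j, s, t) (i', j', s', t')
    = of_bool (i = i' \<and> s = s') + of_bool (j = j' \<and> t = t')
      + of_bool (x i j s = x i' j' s' \<and> y i j t = y i' j' t') + of_bool (i = i' \<and> j = j')
      - of_bool (i = i' \<and> j = j' \<and> s = s') - of_bool (i = i' \<and> j = j' \<and> t = t')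
      - 2 * of_bool (i = i' \<and> j = j' \<and> s = s' \<and> t = t')"
  using q r by (simp add: kernel_def avg_def coord_kernel_def field_simps)

lemma Spec_kernel:
  assumes "bij_betw \<phi> {..<N} (cells q r)"
  shows "Spec (mat N N (\<lambda>(a, b). kernel (\<phi> a) (\<phi> b))) = (\<Sum>p\<in>UNIV. replicate_mset (mult p) (eigval p))"
proof -
  have rep: "repeat_mset n {#a#} = replicate_mset n a" for n and a :: complex
    by (induction n) auto
  have "Spec (mat N N (\<lambda>(a, b). kernel (\<phi> a) (\<phi> b))) = (\<Sum>p\<in>UNIV. proots ([:- eigval p, 1:] ^ mult p))"
    unfolding Spec_def char_poly_kernel[OF assms] by (rule proots_prod) simp
  then show ?thesis by (simp only: proots_power proots_linear_factor rep minus_minus)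
qed

end

subsection \<open>Coordinates of a block-permutational Sudoku Latin square\<close>

lemma permutation_matrix_bij:
  assumes "permutation_matrix n P"
  shows "\<exists>\<sigma>. bij_betw \<sigma> {..<n} {..<n} \<and> (\<forall>s<n. \<forall>t<n. P $$ (s, t) = (if t = \<sigma> s then 1 else 0))"
proof -
  have ex1: "\<forall>s<n. \<exists>!t. t < n \<and> P $$ (s, t) = 1" and col: "\<forall>t<n. \<exists>!s. s < n \<and> P $$ (s, t) = 1"
    and range: "\<forall>s<n. \<forall>t<n. P $$ (s, t) \<in> {0, 1}"
    using assms unfolding permutation_matrix_def by simp_all
  obtain \<sigma> where \<sigma>: "\<And>s. s < n \<Longrightarrow> \<sigma> s < n \<and> P $$ (s, \<sigma> s) = 1"
    using ex1 by metis
  have eq: "P $$ (s, t) = (if t = \<sigma> s then 1 else 0)" if "s < n" "t < n" for s t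
    using that \<sigma>[of s] ex1 range by fastforce
  have "inj_on \<sigma> {..<n}"
    using \<sigma> col by (intro inj_onI) (metis lessThan_iff)
  then have "bij_betw \<sigma> {..<n} {..<n}"
    unfolding bij_betw_def using \<sigma> endo_inj_surj[of "{..<n}" \<sigma>] by auto
  with eq show ?thesis by blast
qed

text \<open>If the ones of \<open>P\<close> and \<open>Q\<close> are at
  \<open>(s, \<sigma> s)\<close> and \<open>(t, \<tau> t)\<close>, then multiplication by the
  inverse of \<open>P\<close> on the left and by \<open>Q\<close> on the right permutes rows and
  columns by the inverses of \<open>\<sigma>\<close> and \<open>\<tau>\<close>.\<close>

lemma block_permutational_pointwise:
  assumes "block_permutational q r L" and "i < r" and "j < q"
  shows "\<exists>x y. bij_betw x {..<q} {..<q} \<and> bij_betw y {..<r} {..<r} \<and>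
    (\<forall>s<q. \<forall>t<r. L (i * q + 1 + s) (j * r + 1 + t) = L (1 + x s) (1 + y t))"
proof -
  have "Suc i \<in> {1..r}" "Suc j \<in> {1..q}" using assms by auto
  then obtain P P' Q where P: "permutation_matrix q P" and Q: "permutation_matrix r Q"
    and P': "P' \<in> carrier_mat q q" and inv: "inverts_mat P P'"
    and sub: "subarray q r L (Suc i) (Suc j) = P' * subarray q r L 1 1 * Q"
    using assms(1) unfolding block_permutational_def by blast
  obtain \<sigma> where \<sigma>: "bij_betw \<sigma> {..<q} {..<q}"
    and P_eq: "\<And>s t. s < q \<Longrightarrow> t < q \<Longrightarrow> P $$ (s, t) = (if t = \<sigma> s then 1 else 0)"
    using permutation_matrix_bij[OF P] by blast
  obtain \<tau> where \<tau>: "bij_betw \<tau> {..<r} {..<r}"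
    and Q_eq: "\<And>s t. s < r \<Longrightarrow> t < r \<Longrightarrow> Q $$ (s, t) = (if t = \<tau> s then 1 else 0)"
    using permutation_matrix_bij[OF Q] by blast
  define x where "x = inv_into {..<q} \<sigma>"
  define y where "y = inv_into {..<r} \<tau>"
  have x: "bij_betw x {..<q} {..<q}" and y: "bij_betw y {..<r} {..<r}"
    unfolding x_def y_def using \<sigma> \<tau> by (auto intro: bij_betw_inv_into)
  have cP: "P \<in> carrier_mat q q" and cQ: "Q \<in> carrier_mat r r"
    using P Q by (auto simp: permutation_matrix_def)
  have x_iff: "s = \<sigma> u \<longleftrightarrow> u = x s" if "s < q" "u < q" for s u
    using that \<sigma> bij_betw_inv_into_left[OF \<sigma>, of u] bij_betw_inv_into_right[OF \<sigma>, of s]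
    by (auto simp: x_def)
  have y_iff: "t = \<tau> v \<longleftrightarrow> v = y t" if "t < r" "v < r" for t v
    using that \<tau> bij_betw_inv_into_left[OF \<tau>, of v] bij_betw_inv_into_right[OF \<tau>, of t]
    by (auto simp: y_def)
  have x_less: "s < q \<Longrightarrow> x s < q" and y_less: "t < r \<Longrightarrow> y t < r" for s t
    using bij_betwE[OF x] bij_betwE[OF y] by auto
  \<comment> \<open>Row \<open>x s\<close> of \<open>P\<close> has its only one in column
    \<open>s\<close>, so row \<open>s\<close> of \<open>P'\<close> is row \<open>x s\<close> of the
    identity \<open>P * P'\<close>.\<close>
  have P'_eq: "P' $$ (s, u) = (if u = x s then 1 else 0)" if su: "s < q" "u < q" for s u
  proof -
    have xs: "x s < q" "s = \<sigma> (x s)" using x_less x_iff su by blast+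
    have "(\<Sum>k\<in>{0..<q}. P $$ (x s, k) * P' $$ (k, u)) = (P * P') $$ (x s, u)"
      using cP P' su xs by (simp add: scalar_prod_def)
    also have "\<dots> = (if u = x s then 1 else 0)"
      using inv cP su xs by (simp add: inverts_mat_def)
    finally have "(\<Sum>k\<in>{0..<q}. if k = s then P' $$ (k, u) else 0) = (if u = x s then 1 else 0)"
      using P_eq[OF xs(1)] xs(2) by (simp add: if_distrib[of "\<lambda>a. a * _"] cong: if_cong)
    then show ?thesis using su by simp
  qed
  have "L (i * q + 1 + s) (j * r + 1 + t) = L (1 + x s) (1 + y t)" if st: "s < q" "t < r" for s t
  proof -
    let ?S = "subarray q r L 1 1"
    have S: "?S \<in> carrier_mat q r" by (simp add: subarray_def)
    have PS: "(P' * ?S) $$ (s, v) = ?S $$ (x s, v)" if "v < r" for v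
    proof -
      have "(P' * ?S) $$ (s, v) = (\<Sum>k\<in>{0..<q}. P' $$ (s, k) * ?S $$ (k, v))"
        using P' S st that by (simp add: scalar_prod_def)
      also have "\<dots> = (\<Sum>k\<in>{0..<q}. if k = x s then ?S $$ (k, v) else 0)"
        using P'_eq st by (intro sum.cong) auto
      finally show ?thesis using x_less st by simp
    qed
    have "int (L (i * q + 1 + s) (j * r + 1 + t)) = subarray q r L (Suc i) (Suc j) $$ (s, t)"
      using st by (simp add: subarray_def)
    also have "\<dots> = (\<Sum>k\<in>{0..<r}. (P' * ?S) $$ (s, k) * Q $$ (k, t))"
    proof -
      have "(M * Q) $$ (s, t) = (\<Sum>k\<in>{0..<r}. M $$ (s, k) * Q $$ (k, t))"
        if "M \<in> carrier_mat q r" for M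
        using that cQ st by (simp add: scalar_prod_def)
      then show ?thesis unfolding sub using P' S by simp
    qed
    also have "\<dots> = (\<Sum>k\<in>{0..<r}. if k = y t then ?S $$ (x s, k) else 0)"
    proof (intro sum.cong refl)
      fix k assume "k \<in> {0..<r}"
      then have k: "k < r" by simp
      show "(P' * ?S) $$ (s, k) * Q $$ (k, t) = (if k = y t then ?S $$ (x s, k) else 0)"
        unfolding PS[OF k] Q_eq[OF k st(2)] y_iff[OF st(2) k] by simp
    qed
    also have "\<dots> = int (L (1 + x s) (1 + y t))"
      using x_less y_less st by (simp add: subarray_def)
    finally show ?thesis by simp
  qed
  then show ?thesis
    by (intro exI[of _ x] exI[of _ y] conjI x y allI impI)
qed

text \<open>Arrays count from 1, cells from 0.\<close>

fun position :: "nat \<Rightarrow> nat \<Rightarrow> quad \<Rightarrow> nat \<times> nat" where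
  "position q r (i, j, s, t) = (i * q + 1 + s, j * r + 1 + t)"

section \<open>Positions of cells and blocks, and properties of Latin squares\<close>

lemma mult_add_eq_iff:
  fixes i i' s s' q :: nat
  assumes "s < q" and "s' < q"
  shows "i * q + s = i' * q + s' \<longleftrightarrow> i = i' \<and> s = s'"
proof -
  have "(i * q + s) div q = i" "(i * q + s) mod q = s"
    "(i' * q + s') div q = i'" "(i' * q + s') mod q = s'"
    using assms by simp_all
  then show ?thesis by metis
qed

lemma mult_add_less:
  fixes i s q n :: nat
  assumes "i < n" and "s < q"
  shows "i * q + s < n * q"
proof -
  have "i * q + s < Suc i * q" using assms by simp
  also have "\<dots> \<le> n * q" using assms by (intro mult_le_mono) auto
  finally show ?thesis .
qed

lemma bij_betw_position: "bij_betw (position q r) (cells q r) ({1..q * r} \<times> {1..q * r})"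
proof (rule bij_betw_byWitness
    [where f' = "\<lambda>(a, b). ((a - 1) div q, (b - 1) div r, (a - 1) mod q, (b - 1) mod r)"])
  show "\<forall>c\<in>cells q r. (\<lambda>(a, b). ((a - 1) div q, (b - 1) div r, (a - 1) mod q, (b - 1) mod r))
      (position q r c) = c"
    by (auto simp: cells_def)
  show "\<forall>z\<in>{1..q * r} \<times> {1..q * r}. position q r ((\<lambda>(a, b).
      ((a - 1) div q, (b - 1) div r, (a - 1) mod q, (b - 1) mod r)) z) = z"
    by auto
  show "position q r ` cells q r \<subseteq> {1..q * r} \<times> {1..q * r}"
  proof
    fix z assume "z \<in> position q r ` cells q r"
    then obtain i j s t where "i < r" "j < q" "s < q" "t < r"
      and z: "z = (i * q + 1 + s, j * r + 1 + t)" by (auto simp: cells_def)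
    then have "i * q + s < q * r" "j * r + t < q * r"
      using mult_add_less[of i r s q] mult_add_less[of j q t r] by (simp_all add: mult.commute)
    then show "z \<in> {1..q * r} \<times> {1..q * r}" by (simp add: z)
  qed
  show "(\<lambda>(a, b). ((a - 1) div q, (b - 1) div r, (a - 1) mod q, (b - 1) mod r)) `
      ({1..q * r} \<times> {1..q * r}) \<subseteq> cells q r"
  proof -
    have "(a - 1) div q < r \<and> (a - 1) mod q < q \<and> (a - 1) div r < q \<and> (a - 1) mod r < r"
      if "a \<in> {1..q * r}" for a
    proof -
      have "a - 1 < r * q" "0 < q" "0 < r" using that by (cases q; cases r; auto simp: mult.commute)+
      then show ?thesis by (simp add: less_mult_imp_div_less mult.commute)
    qed
    then show ?thesis by (auto simp: cells_def)
  qed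
qed

lemma position_in_block_iff:
  assumes "(i, j, s, t) \<in> cells q r" and "1 \<le> i'" and "1 \<le> j'"
  shows "position q r (i, j, s, t) \<in> block q r i' j' \<longleftrightarrow> i' = Suc i \<and> j' = Suc j"
proof -
  have *: "(i' - 1) * n + 1 \<le> i * n + 1 + s \<and> i * n + 1 + s \<le> i' * n \<longleftrightarrow> i' = Suc i"
    if "s < n" "1 \<le> i'" for i i' s n :: nat
  proof
    assume le: "(i' - 1) * n + 1 \<le> i * n + 1 + s \<and> i * n + 1 + s \<le> i' * n"
    have "i * n < i' * n" using le by linarith
    moreover have "(i' - 1) * n < Suc i * n" unfolding mult_Suc using le that by linarith
    ultimately have "i' - 1 < Suc i" "i < i'" by (simp_all only: mult_less_cancel2)
    then show "i' = Suc i" by simp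
  qed (use that in auto)
  show ?thesis using assms *[of s q i' i] *[of t r j' j]
    by (auto simp: block_def cells_def)
qed

text \<open>A self-map of a finite set takes every value exactly once if and only if it is
  injective.\<close>

lemma latin_square_iff_inj:
  "latin_square n L \<longleftrightarrow> (\<forall>a\<in>{1..n}. \<forall>b\<in>{1..n}. L a b \<in> {1..n}) \<and>
     (\<forall>a\<in>{1..n}. inj_on (L a) {1..n}) \<and> (\<forall>b\<in>{1..n}. inj_on (\<lambda>a. L a b) {1..n})"
proof -
  have *: "(\<forall>k\<in>{1..n}. \<exists>!b. b \<in> {1..n} \<and> f b = k) \<longleftrightarrow> inj_on f {1..n}"
    if f: "\<forall>b\<in>{1..n}. f b \<in> {1..n}" for f :: "nat \<Rightarrow> nat"
  proof
    assume ex1: "\<forall>k\<in>{1..n}. \<exists>!b. b \<in> {1..n} \<and> f b = k"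
    show "inj_on f {1..n}"
    proof (rule inj_onI)
      fix b b' assume "b \<in> {1..n}" "b' \<in> {1..n}" "f b = f b'"
      moreover from this have "\<exists>!c. c \<in> {1..n} \<and> f c = f b" using ex1 f by blast
      ultimately show "b = b'" by auto
    qed
  next
    assume inj: "inj_on f {1..n}"
    then have "f ` {1..n} = {1..n}"
      by (intro endo_inj_surj) (use f in auto)
    show "\<forall>k\<in>{1..n}. \<exists>!b. b \<in> {1..n} \<and> f b = k"
    proof
      fix k assume "k \<in> {1..n}"
      then obtain b where "b \<in> {1..n}" "f b = k"
        using \<open>f ` {1..n} = {1..n}\<close> by (metis imageE)
      then show "\<exists>!b. b \<in> {1..n} \<and> f b = k"
        using inj by (intro ex1I[of _ b]) (auto dest: inj_onD)
    qed
  qed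
  have rows: "(\<forall>k\<in>{1..n}. \<exists>!b. b \<in> {1..n} \<and> L a b = k) \<longleftrightarrow> inj_on (L a) {1..n}"
    if "\<forall>a\<in>{1..n}. \<forall>b\<in>{1..n}. L a b \<in> {1..n}" "a \<in> {1..n}" for a
    by (rule *) (use that in simp)
  have cols: "(\<forall>k\<in>{1..n}. \<exists>!a. a \<in> {1..n} \<and> L a b = k) \<longleftrightarrow> inj_on (\<lambda>a. L a b) {1..n}"
    if "\<forall>a\<in>{1..n}. \<forall>b\<in>{1..n}. L a b \<in> {1..n}" "b \<in> {1..n}" for b
    by (rule *[of "\<lambda>a. L a b"]) (use that in simp)
  show ?thesis unfolding latin_square_def
    by (intro conj_cong refl ball_cong; (rule rows cols); assumption)
qed

text \<open>Two distinct cells of a Latin square share at most one of row, column and symbol, so the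
  indicators simply add up; a cell paired with itself is counted three times.\<close>

lemma latin_square_graph_entry:
  assumes L: "latin_square n L" and c: "(a, b) \<in> {1..n} \<times> {1..n}" and d: "(a', b') \<in> {1..n} \<times> {1..n}"
  shows "(if (a, b) \<noteq> (a', b') \<and> (a = a' \<or> b = b' \<or> L a b = L a' b') then 1 else 0 :: complex)
    = of_bool (a = a') + of_bool (b = b') + of_bool (L a b = L a' b') - 3 * of_bool ((a, b) = (a', b'))"
proof -
  have "L a b = L a b' \<longleftrightarrow> b = b'" "L a b' = L a' b' \<longleftrightarrow> a = a'"
    using L c d inj_on_eq_iff[of "L a" "{1..n}"] inj_on_eq_iff[of "\<lambda>a. L a b'" "{1..n}"]
    unfolding latin_square_iff_inj by auto
  then show ?thesis by auto
qed

lemma sudoku_block_inj: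
  assumes L: "sudoku_latin_square q r L" and i: "i \<in> {1..r}" and j: "j \<in> {1..q}"
    and c: "(a, b) \<in> block q r i j" and d: "(a', b') \<in> block q r i j" and eq: "L a b = L a' b'"
  shows "a = a' \<and> b = b'"
proof -
  have "i * q \<le> q * r" "j * r \<le> q * r" using i j by (simp_all add: mult.commute[of q r])
  moreover have "1 \<le> a" "a \<le> i * q" "1 \<le> b" "b \<le> j * r" using c by (auto simp: block_def)
  ultimately have "a \<in> {1..q * r}" "b \<in> {1..q * r}"
    unfolding atLeastAtMost_iff by linarith+
  then have "L a b \<in> {1..q * r}"
    using L by (simp add: sudoku_latin_square_def latin_square_iff_inj)
  then have "\<exists>!c. c \<in> block q r i j \<and> L (fst c) (snd c) = L a b"
    using L i j by (simp add: sudoku_latin_square_def)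
  then show ?thesis using c d eq by (metis fst_conv snd_conv)
qed

text \<open>The coordinates are chosen block by block. Equal coordinates mean equal symbols, so a
  repetition in a row or column would contradict the Latin property.\<close>

lemma block_permutational_coordinatesI:
  assumes q: "2 \<le> q" and r: "2 \<le> r" and L: "sudoku_latin_square q r L" and "block_permutational q r L"
  obtains x y where "block_permutational_coordinates q r x y"
    and "\<And>i j s t. i < r \<Longrightarrow> j < q \<Longrightarrow> s < q \<Longrightarrow> t < r \<Longrightarrow>
      L (i * q + 1 + s) (j * r + 1 + t) = L (1 + x i j s) (1 + y i j t)"
proof -
  have "\<forall>i j. \<exists>x y. i < r \<longrightarrow> j < q \<longrightarrow> bij_betw x {..<q} {..<q} \<and> bij_betw y {..<r} {..<r} \<and>
    (\<forall>s<q. \<forall>t<r. L (i * q + 1 + s) (j * r + 1 + t) = L (1 + x s) (1 + y t))"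
    using block_permutational_pointwise[OF assms(4)] by blast
  then obtain x y where xy: "\<And>i j. i < r \<Longrightarrow> j < q \<Longrightarrow> bij_betw (x i j) {..<q} {..<q} \<and>
    bij_betw (y i j) {..<r} {..<r} \<and>
    (\<forall>s<q. \<forall>t<r. L (i * q + 1 + s) (j * r + 1 + t) = L (1 + x i j s) (1 + y i j t))"
    by metis
  then have eq: "L (i * q + 1 + s) (j * r + 1 + t) = L (1 + x i j s) (1 + y i j t)"
    if "i < r" "j < q" "s < q" "t < r" for i j s t using that by blast
  have inj: "inj_on (L a) {1..q * r}" "inj_on (\<lambda>a. L a b) {1..q * r}"
    if "a \<in> {1..q * r}" "b \<in> {1..q * r}" for a b
    using L that by (simp_all add: sudoku_latin_square_def latin_square_iff_inj)
  have pos: "i * q + 1 + s \<in> {1..q * r}" if "i < r" "s < q" for i s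
    using mult_add_less[OF that] by (simp add: mult.commute)
  have pos': "j * r + 1 + t \<in> {1..q * r}" if "j < q" "t < r" for j t
    using mult_add_less[OF that] by simp
  have "block_permutational_coordinates q r x y"
  proof
    show "inj_on (\<lambda>(j, t). (x i j s, y i j t)) ({..<q} \<times> {..<r})" if "i < r" "s < q" for i s
    proof (rule inj_onI, clarsimp)
      fix j t j' t' assume lt: "j < q" "t < r" "j' < q" "t' < r"
        and "x i j s = x i j' s" "y i j t = y i j' t'"
      then have "L (i * q + 1 + s) (j * r + 1 + t) = L (i * q + 1 + s) (j' * r + 1 + t')"
        using eq that by simp
      then have "j * r + 1 + t = j' * r + 1 + t'"
        using inj_onD[OF inj(1)[OF pos[OF that] pos[OF that]]] lt pos' by blast
      then show "j = j' \<and> t = t'" using mult_add_eq_iff lt by simp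
    qed
    show "inj_on (\<lambda>(i, s). (x i j s, y i j t)) ({..<r} \<times> {..<q})" if "j < q" "t < r" for j t
    proof (rule inj_onI, clarsimp)
      fix i s i' s' assume lt: "i < r" "s < q" "i' < r" "s' < q"
        and "x i j s = x i' j s'" "y i j t = y i' j t"
      then have "L (i * q + 1 + s) (j * r + 1 + t) = L (i' * q + 1 + s') (j * r + 1 + t)"
        using eq that by simp
      then have "i * q + 1 + s = i' * q + 1 + s'"
        using inj_onD[OF inj(2)[OF pos'[OF that] pos'[OF that]]] lt pos by blast
      then show "i = i' \<and> s = s'" using mult_add_eq_iff lt by simp
    qed
  qed (use q r xy in auto)
  then show ?thesis using eq that by blast
qed

text \<open>Stated for any Latin square, as it is applied both before and after the
  interchange.\<close>

lemma sudoku_matrix_entry: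
  assumes L: "latin_square (q * r) L"
    and c: "(i, j, s, t) \<in> cells q r" and d: "(i', j', s', t') \<in> cells q r"
    and kl: "k < q * r * (q * r)" "l < q * r * (q * r)"
    and k: "cell (q * r) k = position q r (i, j, s, t)" and l: "cell (q * r) l = position q r (i', j', s', t')"
  shows "(latin_square_graph_matrix (q * r) L + block_matrix q r) $$ (k, l)
    = of_bool (i = i' \<and> s = s') + of_bool (j = j' \<and> t = t')
      + of_bool (L (i * q + 1 + s) (j * r + 1 + t) = L (i' * q + 1 + s') (j' * r + 1 + t'))
      + of_bool (i = i' \<and> j = j')
      - of_bool (i = i' \<and> j = j' \<and> s = s') - of_bool (i = i' \<and> j = j' \<and> t = t')
      - 2 * of_bool (i = i' \<and> j = j' \<and> s = s' \<and> t = t')"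
proof -
  let ?a = "i * q + 1 + s" and ?b = "j * r + 1 + t" and ?a' = "i' * q + 1 + s'" and ?b' = "j' * r + 1 + t'"
  have lt: "i < r" "j < q" "s < q" "t < r" "i' < r" "j' < q" "s' < q" "t' < r"
    using c d by (auto simp: cells_def)
  have grid: "(?a, ?b) \<in> {1..q * r} \<times> {1..q * r}" "(?a', ?b') \<in> {1..q * r} \<times> {1..q * r}"
    using bij_betwE[OF bij_betw_position] c d by fastforce+
  have eqs: "?a = ?a' \<longleftrightarrow> i = i' \<and> s = s'" "?b = ?b' \<longleftrightarrow> j = j' \<and> t = t'"
    using lt mult_add_eq_iff by simp_all
  have graph: "latin_square_graph_matrix (q * r) L $$ (k, l)
    = of_bool (?a = ?a') + of_bool (?b = ?b') + of_bool (L ?a ?b = L ?a' ?b') - 3 * of_bool ((?a, ?b) = (?a', ?b'))"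
    unfolding latin_square_graph_entry[OF L grid, symmetric]
    using kl by (simp add: latin_square_graph_matrix_def cell_matrix_def k l)
  have "(\<exists>i0\<in>{1..r}. \<exists>j0\<in>{1..q}. position q r (i, j, s, t) \<in> block q r i0 j0
      \<and> position q r (i', j', s', t') \<in> block q r i0 j0) \<longleftrightarrow> i = i' \<and> j = j'"
    using position_in_block_iff[OF c] position_in_block_iff[OF d] lt by (auto simp: Bex_def)
  then have "block_matrix q r $$ (k, l) = of_bool (i = i' \<and> j = j' \<and> ?a \<noteq> ?a' \<and> ?b \<noteq> ?b')"
    using kl by (simp add: block_matrix_def cell_matrix_def k l of_bool_def)
  moreover have "(latin_square_graph_matrix (q * r) L + block_matrix q r) $$ (k, l)
    = latin_square_graph_matrix (q * r) L $$ (k, l) + block_matrix q r $$ (k, l)"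
    using kl by (simp add: block_matrix_def cell_matrix_def)
  ultimately show ?thesis
    unfolding graph prod.inject eqs by auto
qed

text \<open>Each row and each block lies inside or outside the first block row, so there the
  interchange is a relabelling or nothing. In a column, \<open>same_column\<close> ensures that the
  first \<open>q\<close> entries keep their set of symbols.\<close>

lemma sudoku_swap_in_first_row_block:
  assumes L: "sudoku_latin_square q r L" and r: "0 < r"
    and k: "k1 \<in> {1..q * r}" "k2 \<in> {1..q * r}"
    and same_column: "\<And>b. b \<in> {1..q * r} \<Longrightarrow> (\<exists>a\<in>{1..q}. L a b = k1) \<longleftrightarrow> (\<exists>a\<in>{1..q}. L a b = k2)"
  shows "sudoku_latin_square q r (swap_in_first_row_block q r k1 k2 L)"
proof -
  let ?L = "swap_in_first_row_block q r k1 k2 L" and ?tr = "Transposition.transpose k1 k2"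
  have latin: "latin_square (q * r) L" using L by (simp add: sudoku_latin_square_def)
  have top: "(a, b) \<in> (\<Union>j\<in>{1..q}. block q r 1 j) \<longleftrightarrow> a \<le> q" if a: "a \<in> {1..q * r}" and b: "b \<in> {1..q * r}" for a b
  proof
    assume "a \<le> q"
    define m n where "m = (b - 1) div r" and "n = (b - 1) mod r"
    have "b - 1 < q * r" using b by auto
    then have "m < q" by (simp add: m_def less_mult_imp_div_less)
    moreover have "n < r" using r by (simp add: n_def)
    moreover have "b = m * r + 1 + n"
      using div_mult_mod_eq[of "b - 1" r] b unfolding m_def n_def by simp
    ultimately have "(a, b) \<in> block q r 1 (Suc m)" "Suc m \<in> {1..q}"
      using a \<open>a \<le> q\<close> by (auto simp: block_def)
    then show "(a, b) \<in> (\<Union>j\<in>{1..q}. block q r 1 j)" by blast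
  qed (auto simp: block_def)
  have L': "?L a b = (if a \<le> q then ?tr (L a b) else L a b)"
    if "a \<in> {1..q * r}" "b \<in> {1..q * r}" for a b
    unfolding swap_in_first_row_block_def top[OF that] ..
  have range: "L a b \<in> {1..q * r}" and inj: "inj_on (L a) {1..q * r}" "inj_on (\<lambda>a. L a b) {1..q * r}"
    if "a \<in> {1..q * r}" "b \<in> {1..q * r}" for a b
    using latin that by (simp_all add: latin_square_iff_inj)
  have tr_range: "m \<in> {1..q * r} \<Longrightarrow> ?tr m \<in> {1..q * r}" for m
    using k by (auto simp: Transposition.transpose_def)
  have tr_eq: "?tr m = ?tr m' \<longleftrightarrow> m = m'" for m m'
    by (metis transpose_involutory)
  \<comment> \<open>The symbol of the lower cell would also occur among the first \<open>q\<close>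
    entries of its column in \<open>L\<close>.\<close>
  have crossing: False
    if ab: "a \<in> {1..q * r}" "a' \<in> {1..q * r}" "b \<in> {1..q * r}" and "a \<le> q" "\<not> a' \<le> q"
      and eq: "?tr (L a b) = L a' b" for a a' b
  proof -
    have "\<exists>a''\<in>{1..q}. L a'' b = L a' b"
    proof -
      have a: "a \<in> {1..q}" using ab \<open>a \<le> q\<close> by simp
      consider "L a b = k1" "L a' b = k2" | "L a b = k2" "L a' b = k1" | "L a b = L a' b"
        using eq by (auto simp: Transposition.transpose_def split: if_splits)
      then show ?thesis
        using same_column[OF ab(3)] a by cases metis+
    qed
    then obtain a'' where a'': "a'' \<in> {1..q}" "L a'' b = L a' b" ..
    moreover have "q \<le> q * r" using r by simp
    ultimately have "a'' \<in> {1..q * r}" unfolding atLeastAtMost_iff by linarith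
    then have "a'' = a'" using inj_onD[OF inj(2)[OF ab(1) ab(3)]] a'' ab(2) by blast
    then show False using a'' \<open>\<not> a' \<le> q\<close> by simp
  qed
  have "latin_square (q * r) ?L"
    unfolding latin_square_iff_inj
  proof (intro conjI ballI inj_onI)
    fix a b assume "a \<in> {1..q * r}" "b \<in> {1..q * r}"
    then show "?L a b \<in> {1..q * r}" unfolding L'[OF \<open>a \<in> _\<close> \<open>b \<in> _\<close>] using range tr_range by simp
  next
    fix a b b' assume ab: "a \<in> {1..q * r}" "b \<in> {1..q * r}" "b' \<in> {1..q * r}" and "?L a b = ?L a b'"
    then have "L a b = L a b'" by (auto simp: L' tr_eq split: if_splits)
    then show "b = b'" using inj_onD[OF inj(1)[OF ab(1) ab(2)]] ab by blast
  next
    fix b a a' assume ab: "b \<in> {1..q * r}" "a \<in> {1..q * r}" "a' \<in> {1..q * r}" and eq: "?L a b = ?L a' b"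
    then have "L a b = L a' b"
      using crossing[of a a' b] crossing[of a' a b] by (auto simp: L' tr_eq split: if_splits)
    then show "a = a'" using inj_onD[OF inj(2)[OF ab(2) ab(1)]] ab by blast
  qed
  moreover have "\<exists>!c. c \<in> block q r i j \<and> ?L (fst c) (snd c) = m"
    if i: "i \<in> {1..r}" and j: "j \<in> {1..q}" and m: "m \<in> {1..q * r}" for i j m
  proof -
    have ex1: "\<exists>!c. c \<in> block q r i j \<and> L (fst c) (snd c) = m'" if "m' \<in> {1..q * r}" for m'
      using L i j that by (simp add: sudoku_latin_square_def)
    show ?thesis
    proof (cases "i = 1")
      case True
      have "?L (fst c) (snd c) = m \<longleftrightarrow> L (fst c) (snd c) = ?tr m" if "c \<in> block q r i j" for c
      proof -
        have "(fst c, snd c) \<in> (\<Union>j\<in>{1..q}. block q r 1 j)" using that j True by auto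
        then have "?L (fst c) (snd c) = ?tr (L (fst c) (snd c))"
          unfolding swap_in_first_row_block_def by (rule if_P)
        then show ?thesis using tr_eq[of "L (fst c) (snd c)" "?tr m"] by simp
      qed
      then show ?thesis using ex1[OF tr_range[OF m]] by (simp cong: conj_cong)
    next
      case False
      have "?L (fst c) (snd c) = L (fst c) (snd c)" if "c \<in> block q r i j" for c
      proof -
        have "q \<le> (i - 1) * q" using i False by (cases "i - 1") auto
        moreover have "(i - 1) * q + 1 \<le> fst c" using that by (auto simp: block_def)
        ultimately have "q < fst c" by linarith
        then have "(fst c, snd c) \<notin> (\<Union>j\<in>{1..q}. block q r 1 j)"
          by (auto simp: block_def)
        then show ?thesis by (simp add: swap_in_first_row_block_def)
      qed
      then show ?thesis using ex1[OF m] by (simp cong: conj_cong)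
    qed
  qed
  ultimately show ?thesis by (simp add: sudoku_latin_square_def)
qed

section \<open>The spectra before and after the interchange\<close>

theorem theorem5p2:
  fixes q r k1 k2 :: nat and L L' :: "nat \<Rightarrow> nat \<Rightarrow> nat"
    and S X Y :: "real multiset"
  assumes "q \<ge> 2" and "r \<ge> 2"
    and "sudoku_latin_square q r L"
    and "block_permutational q r L"
    and "k1 \<noteq> k2"
    and "\<exists>b\<in>{1..r}. \<exists>a1\<in>{1..q}. \<exists>a2\<in>{1..q}. L a1 b = k1 \<and> L a2 b = k2"
    and "L' = swap_in_first_row_block q r k1 k2 L"
    and "S =
        {#(real q - 1) * (real r - 1) + 3 * real q * real r - 3#}
      + replicate_mset (q + r - 2) ((real q - 1) * (real r - 1) + real q * real r - 3)
      + replicate_mset ((q - 1) * (r - 1)) ((real q - 1) * (real r - 1) - 3)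
      + replicate_mset ((q - 1) * (r - 1)) (real q * real r - 2)
      + replicate_mset ((q + 1) * (r - 1)) (real q * real r - real q - 2)
      + replicate_mset ((q - 1) * (r + 1)) (real q * real r - real r - 2)
      + replicate_mset ((q - 1) * (r - 1) * (q * r - 1)) (- 2)
      + replicate_mset ((r - 1) * (q * r - q - 1)) (- real q - 2)
      + replicate_mset ((q - 1) * (q * r - r - 1)) (- real r - 2)"
    and "X = {# - 2, - real r - 2, real q * real r - 2, real q * real r - real r - 2 #}"
    and "Y =
      {# 1/2 * ((real q - 1) * real r - 4 + e1 * sqrt (((real q)\<^sup>2 + 1) * (real r)\<^sup>2
             + e2 * (2 * real q * (real r - 2) * sqrt ((real r)\<^sup>2 + 4 * real r - 4)))).
         (e1, e2) \<in># {# (1, 1), (1, - 1), (- 1, 1), (- 1, - 1) #} #}"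
  shows "sudoku_latin_square q r L' \<and>
    Spec (latin_square_graph_matrix (q * r) L + block_matrix q r) = image_mset complex_of_real S \<and>
    Spec (latin_square_graph_matrix (q * r) L' + block_matrix q r) =
      (Spec (latin_square_graph_matrix (q * r) L + block_matrix q r) - image_mset complex_of_real X)
      + image_mset complex_of_real Y"
proof -
  note q = assms(1) and r = assms(2) and L = assms(3) and S = assms(8) and X = assms(9) and Y = assms(10)
  obtain x y where coords: "block_permutational_coordinates q r x y"
    and Lxy: "\<And>i j s t. i < r \<Longrightarrow> j < q \<Longrightarrow> s < q \<Longrightarrow> t < r \<Longrightarrow>
      L (i * q + 1 + s) (j * r + 1 + t) = L (1 + x i j s) (1 + y i j t)"
    using block_permutational_coordinatesI[OF q r L assms(4)] by blast
  interpret block_permutational_coordinates q r x y by (rule coords)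
  obtain b a1 a2 where ba: "b \<in> {1..r}" "a1 \<in> {1..q}" "a2 \<in> {1..q}" and k: "L a1 b = k1" "L a2 b = k2"
    using assms(6) by blast
  define x1 x2 y0 where "x1 = a1 - 1" and "x2 = a2 - 1" and "y0 = b - 1"
  have k1: "k1 = L (1 + x1) (1 + y0)" and k2: "k2 = L (1 + x2) (1 + y0)"
    and lt: "x1 < q" "x2 < q" "y0 < r"
    using ba k by (auto simp: x1_def x2_def y0_def)
  have x12: "x1 \<noteq> x2" using k1 k2 assms(5) by auto
  note setting = lt(1,2) x12 lt(3)
  have symbol: "L (1 + u) (1 + v) = L (1 + u') (1 + v') \<longleftrightarrow> u = u' \<and> v = v'"
    if "u < q" "u' < q" "v < r" "v' < r" for u u' v v'
    using sudoku_block_inj[OF L, of 1 1 "1 + u" "1 + v" "1 + u'" "1 + v'"] that q r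
    by (auto simp: block_def)
  have latin: "latin_square (q * r) L" using L by (simp add: sudoku_latin_square_def)
  have le: "q \<le> q * r" "r \<le> q * r" using q r by auto
  have L': "sudoku_latin_square q r L'"
    unfolding assms(7)
  proof (rule sudoku_swap_in_first_row_block[OF L])
    show "k1 \<in> {1..q * r}" "k2 \<in> {1..q * r}"
      using latin ba k le unfolding latin_square_iff_inj by (metis atLeastAtMost_iff order_trans)+
    show "(\<exists>a\<in>{1..q}. L a b = k1) \<longleftrightarrow> (\<exists>a\<in>{1..q}. L a b = k2)" if b: "b \<in> {1..q * r}" for b
    proof -
      define j t where "j = (b - 1) div r" and "t = (b - 1) mod r"
      have "b - 1 < q * r" using b by auto
      then have j: "j < q" by (simp add: j_def less_mult_imp_div_less)
      have t: "t < r" using r by (simp add: t_def)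
      have b: "b = j * r + 1 + t"
        using div_mult_mod_eq[of "b - 1" r] b unfolding j_def t_def by simp
      \<comment> \<open>The symbol in row \<open>u\<close> and column \<open>y0\<close> of the first
        block occurs in this part of column \<open>b\<close> exactly if the column has class
        \<open>y0\<close>. This condition does not involve \<open>u\<close>, so \<open>k1\<close>
        and \<open>k2\<close> occur together.\<close>
      have "(\<exists>a\<in>{1..q}. L a b = L (1 + u) (1 + y0)) \<longleftrightarrow> y 0 j t = y0" if u: "u < q" for u
      proof
        assume "\<exists>a\<in>{1..q}. L a b = L (1 + u) (1 + y0)"
        then obtain s where s: "s < q" and "L (1 + s) b = L (1 + u) (1 + y0)"
          by (metis Suc_le_eq atLeastAtMost_iff le_Suc_ex plus_1_eq_Suc One_nat_def)
        then have "L (1 + x 0 j s) (1 + y 0 j t) = L (1 + u) (1 + y0)"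
          using Lxy[of 0 j s t] j t r b by simp
        then show "y 0 j t = y0"
          using symbol[of "x 0 j s" u "y 0 j t" y0] x_less[of 0 j s] y_less[of 0 j t] u lt j t s r by simp
      next
        assume y: "y 0 j t = y0"
        have "u \<in> x 0 j ` {..<q}"
          using x_bij[of 0 j] u j r unfolding bij_betw_def by simp
        then obtain s where "s < q" "x 0 j s = u" by auto
        then have "L (1 + s) b = L (1 + u) (1 + y0)"
          using Lxy[of 0 j s t] j t r b y by simp
        then show "\<exists>a\<in>{1..q}. L a b = L (1 + u) (1 + y0)"
          using \<open>s < q\<close> by (intro bexI[of _ "1 + s"]) auto
      qed
      then show ?thesis unfolding k1 k2 using lt by simp
    qed
  qed (use r in simp)
  have latin': "latin_square (q * r) L'" using L' by (simp add: sudoku_latin_square_def)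

  define N where "N = q * r * (q * r)"
  \<comment> \<open>The enumeration of the quadruples that matches the row by row enumeration of
    array cells by \<open>cell\<close>.\<close>
  define \<phi> where "\<phi> = inv_into (cells q r) (position q r) \<circ> cell (q * r)"
  have \<phi>: "bij_betw \<phi> {..<N} (cells q r)"
    unfolding \<phi>_def N_def
    by (rule bij_betw_trans[OF bij_betw_cell bij_betw_inv_into[OF bij_betw_position]])
  have cell_\<phi>: "cell (q * r) k = position q r (\<phi> k)" if "k < N" for k
  proof -
    have "cell (q * r) k \<in> {1..q * r} \<times> {1..q * r}"
      using bij_betwE[OF bij_betw_cell] that unfolding N_def by blast
    then show ?thesis
      unfolding \<phi>_def o_def using bij_betw_inv_into_right[OF bij_betw_position] by metis
  qed
  let ?A = "latin_square_graph_matrix (q * r) L + block_matrix q r"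
  let ?A' = "latin_square_graph_matrix (q * r) L' + block_matrix q r"
  let ?sw = "swapped_kernel x1 x2 y0"
  have A: "?A = mat N N (\<lambda>(k, l). kernel (\<phi> k) (\<phi> l))"
  proof (rule eq_matI)
    fix k l assume "k < dim_row (mat N N (\<lambda>(k, l). kernel (\<phi> k) (\<phi> l)))"
      "l < dim_col (mat N N (\<lambda>(k, l). kernel (\<phi> k) (\<phi> l)))"
    then have kl: "k < N" "l < N" by auto
    obtain i j s t i' j' s' t' where c: "\<phi> k = (i, j, s, t)" and d: "\<phi> l = (i', j', s', t')"
      by (metis prod.exhaust)
    have cd: "(i, j, s, t) \<in> cells q r" "(i', j', s', t') \<in> cells q r"
      using bij_betwE[OF \<phi>] kl c d by (metis lessThan_iff)+
    then have "L (i * q + 1 + s) (j * r + 1 + t) = L (i' * q + 1 + s') (j' * r + 1 + t')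
        \<longleftrightarrow> x i j s = x i' j' s' \<and> y i j t = y i' j' t'"
      unfolding cells_def by (simp only: mem_Times_iff fst_conv snd_conv lessThan_iff Lxy symbol x_less y_less)
    then show "?A $$ (k, l) = mat N N (\<lambda>(k, l). kernel (\<phi> k) (\<phi> l)) $$ (k, l)"
      using sudoku_matrix_entry[OF latin cd kl[unfolded N_def]] kl cell_\<phi>[of k] cell_\<phi>[of l] c d
      by (simp add: kernel_entry)
  qed (simp_all add: N_def block_matrix_def cell_matrix_def)
  have A': "?A' = mat N N (\<lambda>(k, l). ?sw (\<phi> k) (\<phi> l))"
  proof (rule eq_matI)
    fix k l assume "k < dim_row (mat N N (\<lambda>(k, l). ?sw (\<phi> k) (\<phi> l)))"
      "l < dim_col (mat N N (\<lambda>(k, l). ?sw (\<phi> k) (\<phi> l)))"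
    then have kl: "k < N" "l < N" by auto
    obtain i j s t i' j' s' t' where c: "\<phi> k = (i, j, s, t)" and d: "\<phi> l = (i', j', s', t')"
      by (metis prod.exhaust)
    have cd: "(i, j, s, t) \<in> cells q r" "(i', j', s', t') \<in> cells q r"
      using bij_betwE[OF \<phi>] kl c d by (metis lessThan_iff)+
    define m m' where "m = L (i * q + 1 + s) (j * r + 1 + t)" and "m' = L (i' * q + 1 + s') (j' * r + 1 + t')"
    have sym: "m = m' \<longleftrightarrow> x i j s = x i' j' s' \<and> y i j t = y i' j' t'"
      using cd unfolding m_def m'_def cells_def
      by (simp only: mem_Times_iff fst_conv snd_conv lessThan_iff Lxy symbol x_less y_less)
    have swapped: "L' (i * q + 1 + s) (j * r + 1 + t)
        = (if i = 0 then Transposition.transpose k1 k2 (L (i * q + 1 + s) (j * r + 1 + t))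
           else L (i * q + 1 + s) (j * r + 1 + t))"
      and top: "swap_top x1 x2 y0 (i, j, s, t) = of_bool (i = 0)
        * (of_bool (L (i * q + 1 + s) (j * r + 1 + t) = k1) - of_bool (L (i * q + 1 + s) (j * r + 1 + t) = k2))"
      and rest: "swap_rest x1 x2 y0 (i, j, s, t) = of_bool (i \<noteq> 0)
        * (of_bool (L (i * q + 1 + s) (j * r + 1 + t) = k1) - of_bool (L (i * q + 1 + s) (j * r + 1 + t) = k2))"
      if c: "(i, j, s, t) \<in> cells q r" for i j s t
    proof -
      have ijst: "i < r" "j < q" "s < q" "t < r" using c by (auto simp: cells_def)
      have "(i * q + 1 + s, j * r + 1 + t) \<in> (\<Union>j\<in>{1..q}. block q r 1 j) \<longleftrightarrow> i = 0"
        using position_in_block_iff[OF c, of 1] ijst by auto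
      then show "L' (i * q + 1 + s) (j * r + 1 + t)
        = (if i = 0 then Transposition.transpose k1 k2 (L (i * q + 1 + s) (j * r + 1 + t))
           else L (i * q + 1 + s) (j * r + 1 + t))"
        unfolding assms(7) swap_in_first_row_block_def by simp
      have "L (i * q + 1 + s) (j * r + 1 + t) = k1 \<longleftrightarrow> x i j s = x1 \<and> y i j t = y0"
        "L (i * q + 1 + s) (j * r + 1 + t) = k2 \<longleftrightarrow> x i j s = x2 \<and> y i j t = y0"
        unfolding Lxy[OF ijst] k1 k2 using ijst lt by (simp_all only: symbol x_less y_less)
      then show "swap_top x1 x2 y0 (i, j, s, t) = of_bool (i = 0)
        * (of_bool (L (i * q + 1 + s) (j * r + 1 + t) = k1) - of_bool (L (i * q + 1 + s) (j * r + 1 + t) = k2))"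
        and "swap_rest x1 x2 y0 (i, j, s, t) = of_bool (i \<noteq> 0)
        * (of_bool (L (i * q + 1 + s) (j * r + 1 + t) = k1) - of_bool (L (i * q + 1 + s) (j * r + 1 + t) = k2))"
        by (auto simp: swap_top_def[OF setting] swap_rest_def[OF setting] direction.simps[OF setting]
            sgn_x_def[OF setting])
    qed
    \<comment> \<open>For \<open>m\<close> inside and \<open>m'\<close> outside the first block row,
      the product of the two differences is 1 where an agreement is lost, -1 where one is gained and
      0 elsewhere. If both cells lie on the same side, both products vanish.\<close>
    have swap_eq: "of_bool ((if P then Transposition.transpose k1 k2 m else m)
        = (if P' then Transposition.transpose k1 k2 m' else m')) = (of_bool (m = m')
        - of_bool P * (of_bool (m = k1) - of_bool (m = k2)) * (of_bool (\<not> P') * (of_bool (m' = k1) - of_bool (m' = k2)))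
        - of_bool (\<not> P) * (of_bool (m = k1) - of_bool (m = k2)) * (of_bool P' * (of_bool (m' = k1) - of_bool (m' = k2)))
        :: complex)" for P P' :: bool and m m' :: nat
      using assms(5) by (auto simp: Transposition.transpose_def)
    have "?A' $$ (k, l) = kernel (i, j, s, t) (i', j', s', t') - of_bool (m = m')
        + of_bool (L' (i * q + 1 + s) (j * r + 1 + t) = L' (i' * q + 1 + s') (j' * r + 1 + t'))"
      using sudoku_matrix_entry[OF latin' cd kl[unfolded N_def]] kl cell_\<phi>[of k] cell_\<phi>[of l] c d
      by (simp add: kernel_entry sym)
    also have "\<dots> = ?sw (i, j, s, t) (i', j', s', t')"
      unfolding swapped[OF cd(1)] swapped[OF cd(2)] swapped_kernel_def[OF setting]
        top[OF cd(1)] top[OF cd(2)] rest[OF cd(1)] rest[OF cd(2)] m_def[symmetric] m'_def[symmetric] swap_eq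
      by simp
    finally show "?A' $$ (k, l) = mat N N (\<lambda>(k, l). ?sw (\<phi> k) (\<phi> l)) $$ (k, l)"
      using kl c d by simp
  qed (simp_all add: N_def block_matrix_def cell_matrix_def)

  have S_eq: "Spec ?A = image_mset complex_of_real S"
  proof -
    \<comment> \<open>Three pairs of parts share an eigenvalue: \<open>Band\<close> with
      \<open>Stack\<close>, \<open>Col\<close> with \<open>YClass\<close>, and \<open>Row\<close>
      with \<open>XClass\<close>. Their multiplicities add up to the listed ones.\<close>
    have split: "q + r - 2 = (r - 1) + (q - 1)" "(q + 1) * (r - 1) = q * (r - 1) + (r - 1)"
      "(q - 1) * (r + 1) = (q - 1) * r + (q - 1)"
      using q r by (simp_all add: algebra_simps)
    have vals: "complex_of_real ((real q - 1) * (real r - 1) + 3 * real q * real r - 3) = eigval Top"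
      "complex_of_real ((real q - 1) * (real r - 1) + real q * real r - 3) = eigval Band"
      "complex_of_real ((real q - 1) * (real r - 1) - 3) = eigval Blk"
      "complex_of_real (real q * real r - 2) = eigval Sym"
      "complex_of_real (real q * real r - real q - 2) = eigval YClass"
      "complex_of_real (real q * real r - real r - 2) = eigval XClass"
      "complex_of_real (- 2) = eigval Fine"
      "complex_of_real (- real q - 2) = eigval BCol"
      "complex_of_real (- real r - 2) = eigval BRow"
      by (simp_all add: algebra_simps)
    have same: "eigval Stack = eigval Band" "eigval Col = eigval YClass" "eigval Row = eigval XClass"
      by simp_all
    have "Spec ?A = (\<Sum>p\<in>UNIV. replicate_mset (mult p) (eigval p))"
      unfolding A by (rule Spec_kernel[OF \<phi>])
    also have "\<dots> = image_mset complex_of_real S"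
      unfolding S split replicate_mset_add image_mset_union image_replicate_mset image_mset_single vals
        UNIV_part
      by (simp add: same ac_simps del: eigval.simps)
    finally show ?thesis .
  qed
  have "Spec ?A' + image_mset complex_of_real X = Spec ?A + image_mset complex_of_real Y"
  proof -
    let ?H = "four_block_mat restriction (0\<^sub>m 2 2) (- 1\<^sub>m 2) (restriction - of_nat r \<cdot>\<^sub>m 1\<^sub>m 2)"
    let ?H' = "four_block_mat (restriction - twist) (- twist) (- 1\<^sub>m 2) (restriction - of_nat r \<cdot>\<^sub>m 1\<^sub>m 2)"
    have cp: "char_poly ?A' * char_poly ?H = char_poly ?A * char_poly ?H'"
      unfolding A A' by (rule char_poly_swapped_kernel[OF setting \<phi>])
    have nz: "char_poly ?A \<noteq> 0" "char_poly ?A' \<noteq> 0"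
      using degree_monic_char_poly[of ?A N] degree_monic_char_poly[of ?A' N] unfolding A A' by auto
    have H_nz: "char_poly ?H \<noteq> 0" unfolding char_poly_restriction by simp
    have H'_nz: "char_poly ?H' \<noteq> 0" unfolding char_poly_twisted by simp
    have "Spec ?A' + proots (char_poly ?H) = Spec ?A + proots (char_poly ?H')"
      unfolding Spec_def using cp nz H_nz H'_nz by (metis proots_mult)
    moreover have "proots (char_poly ?H) = image_mset complex_of_real X"
      unfolding char_poly_restriction X by (simp add: proots_mult del: mult_pCons_left mult_pCons_right)
    moreover have "proots (char_poly ?H') = image_mset complex_of_real Y"
      unfolding char_poly_twisted Y by (simp add: proots_mult del: mult_pCons_left mult_pCons_right)
    ultimately show ?thesis by simp
  qed
  \<comment> \<open>Multiset difference is truncated, so moving \<open>X\<close> to the other side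
    requires that it is contained in the spectrum. Its members belong to four different listed
    entries, all of positive multiplicity.\<close>
  moreover have "image_mset complex_of_real X \<subseteq># Spec ?A"
  proof -
    have "2 * r \<le> q * r" "r + 2 \<le> 2 * r" using q r by auto
    then have "0 < q * r - r - 1" "0 < q * r - 1" by linarith+
    then have "0 < (q - 1) * (r - 1)" "0 < (q - 1) * (r + 1)" "0 < (q - 1) * (r - 1) * (q * r - 1)"
      "0 < (q - 1) * (q * r - r - 1)"
      using q r by simp_all
    then obtain n1 n2 n3 n4 where "(q - 1) * (r - 1) = Suc n1" "(q - 1) * (r + 1) = Suc n2"
      "(q - 1) * (r - 1) * (q * r - 1) = Suc n3" "(q - 1) * (q * r - r - 1) = Suc n4"
      by (metis gr0_conv_Suc)
    then have "X \<subseteq># S"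
      unfolding S X by (simp del: mult_Suc mult_Suc_right)
    then show ?thesis unfolding S_eq by (rule image_mset_subseteq_mono)
  qed
  ultimately have "Spec ?A' = Spec ?A - image_mset complex_of_real X + image_mset complex_of_real Y"
    by (metis add_diff_cancel_right' subset_mset.diff_add_assoc2)
  then show ?thesis using L' S_eq by blast
qed

end
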